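(* Let $\mathcal{E}=(L|K,v)$ be a Galois defect extension of prime degree $p=\operatorname{char}Kv$, and if $\operatorname{char}K=0$, assume that $K$ contains all $p$-th roots of unity. Then $$\operatorname{Tr}_{L|K}(\mathcal{O}_L)=\operatorname{Tr}_{L|K}(\mathcal{M}_L)=(b\in K\mid vb\in(p-1)\Sigma_{\mathcal{E}})=(I_{\mathcal{E}}\cap K)^{p-1}.$$ The extension $\mathcal{E}$ has independent defect if and only if for some strongly convex subgroup $H$ of $vL$, $$\operatorname{Tr}_{L|K}(\mathcal{O}_L)=\operatorname{Tr}_{L|K}(\mathcal{M}_L)=\mathcal{M}_{v_H}\cap K=(b\in K\mid vb>H).\qquad( * )$$ In particular, if $H=\{0\}$ (which is always the case if $vK$ is archimedean, or more generally, if $(vK)_{vp}$ is archimedean), then this means that $$\operatorname{Tr}_{L|K}(\mathcal{M}_L)=\mathcal{M}_K .$$ In the mixed characteristic case ($\operatorname{char}K=0$, $\operatorname{char}Kv=p$), if $( * )$ holds, then $\mathcal{M}_{v_H}$ contains $p$, so that $\operatorname{char}Kv_H=p$.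
   Context: $(L|K,v)$ denotes a field extension $L|K$ with a (Krull) valuation $v$ on $L$ of arbitrary rank (written additively, $v0=\infty$), $K$ being endowed with the restriction of $v$. $\mathcal{O}_L,\mathcal{O}_K$ are the valuation rings, $\mathcal{M}_L,\mathcal{M}_K$ their maximal ideals, $vL,vK$ the value groups, $Lv,Kv$ the residue fields. $\operatorname{Tr}_{L|K}$ is the trace. $(L|K,v)$ is unibranched if the extension of $v$ from $K$ to $L$ is unique. For a finite unibranched extension, $[L:K]=\tilde p^{\,\nu}(vL:vK)[Lv:Kv]$ with an integer $\nu\ge0$, where $\tilde p=\operatorname{char}Kv$ if this is positive and $\tilde p=1$ otherwise; it is a defect extension if $\tilde p^{\,\nu}>1$. A defect extension of prime degree is always tacitly assumed to be unibranched; hence its degree is $p=\operatorname{char}Kv$, $vL=vK$ and $Lv=Kv$. For $\mathcal{E}=(L|K,v)$ a Galois defect extension of prime degree $p$ and $\mathrm{id}\neq\sigma\in\operatorname{Gal}(L|K)$, the set $\Sigma_{\mathcal{E}}=\{v(\frac{\sigma b-b}{b})\mid b\in L^\times,\ \sigma b\ne b\}$ is a final segment of $vL^{>0}$ and does not depend on the choice of $\sigma$. The ramification ideal of $\mathcal{E}$ is the $\mathcal{O}_L$-ideal $I_{\mathcal{E}}=\{a\in L\mid va\in\Sigma_{\mathcal{E}}\}\cup\{0\}$. For a set $\Sigma$ and $n\in\mathbb{N}$, $n\Sigma=\{ns\mid s\in\Sigma\}$. For a condition on elements $b\in K$, $(b\in K\mid\ldots)$ denotes the $\mathcal{O}_K$-ideal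 generated by the elements satisfying it; powers of $I_{\mathcal{E}}\cap K$ are taken as powers of $\mathcal{O}_K$-ideals. A strongly convex subgroup of an ordered abelian group $\Gamma$ is a proper convex subgroup $H$ such that $\Gamma/H$ has no smallest positive element. $\alpha>H$ means $\alpha>h$ for all $h\in H$. $\mathcal{E}$ has independent defect if $\Sigma_{\mathcal{E}}=\{\alpha\in vL\mid\alpha>H\}$ for some strongly convex subgroup $H$ of $vL$. For a convex subgroup $H$ of $vL$, $v_H$ is the corresponding coarsening of $v$ on $L$, with value group $vL/H$ and maximal ideal $\mathcal{M}_{v_H}=\{a\in L\mid va>H\}$; $Kv_H$ is the residue field of $K$ under $v_H$. If $\operatorname{char}K=0$, $(vK)_{vp}$ is the smallest convex subgroup of $vK$ containing $vp$; if $\operatorname{char}K>0$, $(vK)_{vp}=vK$. An ordered abelian group is archimedean if it is order isomorphic to a subgroup of $\mathbb{R}$. *)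

theory Defs
  imports "HOL-Algebra.Algebra"
    "HOL-Algebra.Algebraic_Closure_Type" "HOL-Computational_Algebra.Primes"
begin

text \<open>
  The big field \<open>L\<close> is a type \<open>'a :: field\<close> and \<open>K\<close> is a subset of it. The library ring
  \<open>ring_of_type_algebra\<close> is \<open>L\<close> as a HOL-Algebra record.
\<close>

abbreviation ring_on :: "'a::field set \<Rightarrow> 'a ring" where
  "ring_on S \<equiv> ring_of_type_algebra\<lparr>carrier := S\<rparr>"

text \<open>Same definition as the library's \<^term>\<open>CHAR('a::semiring_1)\<close>, but for a ring given as a record.\<close>

definition ring_char :: "('b, 'm) ring_scheme \<Rightarrow> nat" where
  "ring_char R = Gcd {n::nat. add_pow R n \<one>\<^bsub>R\<^esub> = \<zero>\<^bsub>R\<^esub>}"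


section \<open>Field extensions\<close>

text \<open>By convention the degree of an infinite extension is \<open>0\<close>.\<close>

definition ext_degree :: "('b, 'm) ring_scheme \<Rightarrow> 'b set \<Rightarrow> nat" where
  "ext_degree R k =
     (if ring.finite_dimension R k (carrier R) then ring.dim R k (carrier R) else 0)"

definition is_basis :: "'a::field set \<Rightarrow> 'a list \<Rightarrow> bool" where
  "is_basis K B \<longleftrightarrow>
     ring.independent ring_of_type_algebra K B \<and> ring.Span ring_of_type_algebra K B = UNIV"

definition coords :: "'a::field set \<Rightarrow> 'a list \<Rightarrow> 'a \<Rightarrow> 'a list" where
  "coords K B x =
     (THE cs. set cs \<subseteq> K \<and> length cs = length B \<and> ring.combine ring_of_type_algebra cs B = x)"

text \<open>The trace of the \<open>K\<close>-linear map \<open>y \<mapsto> x * y\<close> on \<open>L\<close> (for a finite extension).\<close>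

definition field_trace :: "'a::field set \<Rightarrow> 'a \<Rightarrow> 'a" where
  "field_trace K x =
     (let B = (SOME B. is_basis K B) in \<Sum>i<length B. coords K B (x * B ! i) ! i)"

definition galois_group :: "'a::field set \<Rightarrow> ('a \<Rightarrow> 'a) set" where
  "galois_group K =
     {\<sigma> \<in> ring_iso ring_of_type_algebra ring_of_type_algebra. \<forall>x\<in>K. \<sigma> x = x}"

definition finite_galois :: "'a::field set \<Rightarrow> bool" where
  "finite_galois K \<longleftrightarrow>
     ext_degree (ring_of_type_algebra :: 'a ring) K > 0 \<and>
     {x. \<forall>\<sigma>\<in>galois_group K. \<sigma> x = x} = K"

definition contains_all_roots_of_unity :: "nat \<Rightarrow> 'a::field set \<Rightarrow> bool" where
  "contains_all_roots_of_unity n K \<longleftrightarrow> {z :: 'a alg_closure. z ^ n = 1} \<subseteq> to_ac ` K"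


section \<open>Ordered abelian groups\<close>

text \<open>
  An ordered abelian group is a subgroup \<open>\<Gamma>\<close> (as a set) of an ambient linearly ordered abelian
  group type.
\<close>

definition convex_subgroup ::
    "'g::linordered_ab_group_add set \<Rightarrow> 'g set \<Rightarrow> bool" where
  "convex_subgroup \<Gamma> H \<longleftrightarrow>
     H \<subseteq> \<Gamma> \<and> 0 \<in> H \<and> (\<forall>a\<in>H. \<forall>b\<in>H. a + b \<in> H) \<and> (\<forall>a\<in>H. - a \<in> H) \<and>
     (\<forall>a\<in>H. \<forall>b\<in>H. \<forall>c\<in>\<Gamma>. a \<le> c \<and> c \<le> b \<longrightarrow> c \<in> H)"

definition group_quotient ::
    "'g::linordered_ab_group_add set \<Rightarrow> 'g set \<Rightarrow> 'g set set" where
  "group_quotient \<Gamma> H = (\<lambda>a. (+) a ` H) ` \<Gamma>"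

text \<open>The induced order on the cosets of a convex subgroup.\<close>

definition coset_le :: "'g::linordered_ab_group_add set \<Rightarrow> 'g set \<Rightarrow> bool" where
  "coset_le A B \<longleftrightarrow> (\<exists>a\<in>A. \<exists>b\<in>B. a \<le> b)"

definition positive_cosets ::
    "'g::linordered_ab_group_add set \<Rightarrow> 'g set \<Rightarrow> 'g set set" where
  "positive_cosets \<Gamma> H = {A \<in> group_quotient \<Gamma> H. coset_le H A \<and> A \<noteq> H}"

definition strongly_convex ::
    "'g::linordered_ab_group_add set \<Rightarrow> 'g set \<Rightarrow> bool" where
  "strongly_convex \<Gamma> H \<longleftrightarrow>
     convex_subgroup \<Gamma> H \<and> H \<noteq> \<Gamma> \<and>
     \<not> (\<exists>A \<in> positive_cosets \<Gamma> H. \<forall>B \<in> positive_cosets \<Gamma> H. coset_le A B)"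

definition archimedean_group :: "'g::linordered_ab_group_add set \<Rightarrow> bool" where
  "archimedean_group \<Gamma> \<longleftrightarrow>
     (\<exists>f :: 'g \<Rightarrow> real. (\<forall>a\<in>\<Gamma>. \<forall>b\<in>\<Gamma>. f (a + b) = f a + f b) \<and> strict_mono_on \<Gamma> f)"


section \<open>Valuations\<close>

text \<open>
  The value \<open>v 0 = \<infinity>\<close> is not represented: the function \<open>v\<close> is only meaningful on nonzero
  elements, and \<open>0\<close> is always treated separately.
\<close>

definition valuation :: "('a::field \<Rightarrow> 'g::linordered_ab_group_add) \<Rightarrow> bool" where
  "valuation v \<longleftrightarrow>
     (\<forall>x y. x \<noteq> 0 \<longrightarrow> y \<noteq> 0 \<longrightarrow> v (x * y) = v x + v y) \<and>
     (\<forall>x y. x \<noteq> 0 \<longrightarrow> y \<noteq> 0 \<longrightarrow> x + y \<noteq> 0 \<longrightarrow> min (v x) (v y) \<le> v (x + y))"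

text \<open>
  In the following definitions \<open>F\<close> is a subfield with the restriction of \<open>v\<close>; it will be \<open>K\<close>
  or \<open>L = UNIV\<close>.
\<close>

definition value_group ::
    "('a::field \<Rightarrow> 'g::linordered_ab_group_add) \<Rightarrow> 'a set \<Rightarrow> 'g set" where
  "value_group v F = v ` (F - {0})"

definition val_ring ::
    "('a::field \<Rightarrow> 'g::linordered_ab_group_add) \<Rightarrow> 'a set \<Rightarrow> 'a set" where
  "val_ring v F = {x \<in> F. x = 0 \<or> 0 \<le> v x}"

definition max_ideal ::
    "('a::field \<Rightarrow> 'g::linordered_ab_group_add) \<Rightarrow> 'a set \<Rightarrow> 'a set" where
  "max_ideal v F = {x \<in> F. x = 0 \<or> 0 < v x}"

definition residue_field ::
    "('a::field \<Rightarrow> 'g::linordered_ab_group_add) \<Rightarrow> 'a set \<Rightarrow> 'a set ring" where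
  "residue_field v F = ring_on (val_ring v F) Quot max_ideal v F"

text \<open>
  The coarsening \<open>v\<^sub>H\<close> has values in the quotient by \<open>H\<close>; the coset of \<open>v x\<close> is \<open>\<ge> 0\<close> iff
  \<open>v x\<close> is above some element of \<open>H\<close>, and \<open>> 0\<close> iff \<open>v x\<close> is above all of them.
\<close>

definition coarse_ring ::
    "('a::field \<Rightarrow> 'g::linordered_ab_group_add) \<Rightarrow> 'g set \<Rightarrow> 'a set \<Rightarrow> 'a set" where
  "coarse_ring v H F = {x \<in> F. x = 0 \<or> (\<exists>h\<in>H. h \<le> v x)}"

definition coarse_max_ideal ::
    "('a::field \<Rightarrow> 'g::linordered_ab_group_add) \<Rightarrow> 'g set \<Rightarrow> 'a set \<Rightarrow> 'a set" where
  "coarse_max_ideal v H F = {x \<in> F. x = 0 \<or> (\<forall>h\<in>H. h < v x)}"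

definition coarse_residue_field ::
    "('a::field \<Rightarrow> 'g::linordered_ab_group_add) \<Rightarrow> 'g set \<Rightarrow> 'a set \<Rightarrow> 'a set ring" where
  "coarse_residue_field v H F = ring_on (coarse_ring v H F) Quot coarse_max_ideal v H F"

text \<open>The group \<open>(vK)\<^sub>v\<^sub>p\<close>. Note that the characteristic of \<open>K\<close> is that of \<open>L\<close>.\<close>

definition vp_group ::
    "('a::field \<Rightarrow> 'g::linordered_ab_group_add) \<Rightarrow> 'a set \<Rightarrow> nat \<Rightarrow> 'g set" where
  "vp_group v K p =
     (if CHAR('a) = 0
      then \<Inter>{C. convex_subgroup (value_group v K) C \<and> v (of_nat p) \<in> C}
      else value_group v K)"


section \<open>Extensions of valued fields\<close>

text \<open>
  Two extensions of \<open>v\<close> are identified when they are equivalent, i.e. have the same valuation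
  ring; so extensions to \<open>L\<close> are represented by the valuation rings of \<open>L\<close> lying over that
  of \<open>K\<close>.
\<close>

definition valuation_subring :: "'a::field set \<Rightarrow> bool" where
  "valuation_subring A \<longleftrightarrow>
     subring A ring_of_type_algebra \<and> (\<forall>x. x \<noteq> 0 \<longrightarrow> x \<in> A \<or> inverse x \<in> A)"

definition unibranched ::
    "'a::field set \<Rightarrow> ('a \<Rightarrow> 'g::linordered_ab_group_add) \<Rightarrow> bool" where
  "unibranched K v \<longleftrightarrow>
     (\<forall>A. valuation_subring A \<and> A \<inter> K = val_ring v K \<longrightarrow> A = val_ring v UNIV)"

definition ramification_index ::
    "'a::field set \<Rightarrow> ('a \<Rightarrow> 'g::linordered_ab_group_add) \<Rightarrow> nat" where
  "ramification_index K v = card (group_quotient (value_group v UNIV) (value_group v K))"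

text \<open>\<open>Kv\<close> is embedded into \<open>Lv\<close> by sending the residue of \<open>x\<close> to the residue of \<open>x\<close>.\<close>

definition inertia_degree ::
    "'a::field set \<Rightarrow> ('a \<Rightarrow> 'g::linordered_ab_group_add) \<Rightarrow> nat" where
  "inertia_degree K v =
     ext_degree (residue_field v UNIV)
       ((\<lambda>x. max_ideal v UNIV +>\<^bsub>ring_on (val_ring v UNIV)\<^esub> x) ` val_ring v K)"

definition char_exponent ::
    "'a::field set \<Rightarrow> ('a \<Rightarrow> 'g::linordered_ab_group_add) \<Rightarrow> nat" where
  "char_exponent K v =
     (if ring_char (residue_field v K) > 0 then ring_char (residue_field v K) else 1)"

definition defect_extension ::
    "'a::field set \<Rightarrow> ('a \<Rightarrow> 'g::linordered_ab_group_add) \<Rightarrow> bool" where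
  "defect_extension K v \<longleftrightarrow>
     ext_degree (ring_of_type_algebra :: 'a ring) K > 0 \<and> unibranched K v \<and>
     (\<exists>\<nu>. ext_degree (ring_of_type_algebra :: 'a ring) K =
            char_exponent K v ^ \<nu> * ramification_index K v * inertia_degree K v \<and>
          char_exponent K v ^ \<nu> > 1)"


section \<open>The ramification ideal, independent defect and the trace condition\<close>

definition ram_Sigma ::
    "('a::field \<Rightarrow> 'g::linordered_ab_group_add) \<Rightarrow> ('a \<Rightarrow> 'a) \<Rightarrow> 'g set" where
  "ram_Sigma v \<sigma> = {v ((\<sigma> b - b) / b) | b. b \<noteq> 0 \<and> \<sigma> b \<noteq> b}"

definition ram_ideal ::
    "('a::field \<Rightarrow> 'g::linordered_ab_group_add) \<Rightarrow> ('a \<Rightarrow> 'a) \<Rightarrow> 'a set" where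
  "ram_ideal v \<sigma> = {a. a \<noteq> 0 \<and> v a \<in> ram_Sigma v \<sigma>} \<union> {0}"

definition set_multiple :: "nat \<Rightarrow> 'g::linordered_ab_group_add set \<Rightarrow> 'g set" where
  "set_multiple n S = {\<Sum>i<n. s | s. s \<in> S}"

definition above_subgroup ::
    "('a::field \<Rightarrow> 'g::linordered_ab_group_add) \<Rightarrow> 'g set \<Rightarrow> 'g set" where
  "above_subgroup v H = {\<alpha> \<in> value_group v UNIV. \<forall>h\<in>H. h < \<alpha>}"

definition independent_defect ::
    "('a::field \<Rightarrow> 'g::linordered_ab_group_add) \<Rightarrow> ('a \<Rightarrow> 'a) \<Rightarrow> bool" where
  "independent_defect v \<sigma> \<longleftrightarrow>
     (\<exists>H. strongly_convex (value_group v UNIV) H \<and> ram_Sigma v \<sigma> = above_subgroup v H)"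

definition trace_condition ::
    "'a::field set \<Rightarrow> ('a \<Rightarrow> 'g::linordered_ab_group_add) \<Rightarrow> 'g set \<Rightarrow> bool" where
  "trace_condition K v H \<longleftrightarrow>
     field_trace K ` val_ring v UNIV = field_trace K ` max_ideal v UNIV \<and>
     field_trace K ` max_ideal v UNIV = coarse_max_ideal v H UNIV \<inter> K \<and>
     coarse_max_ideal v H UNIV \<inter> K =
       Idl\<^bsub>ring_on (val_ring v K)\<^esub> {b \<in> K. b = 0 \<or> (\<forall>h\<in>H. h < v b)}"

end

theory Submission
  imports Defs
begin

text \<open>
  The idea is to read everything off the operator \<open>\<delta> = \<sigma> - 1\<close>. The fundamental equality for a defect extension of prime degree leaves no room for
  ramification or residue extension: \<open>vL = vK\<close>, \<open>Lv = Kv\<close>, and uniqueness of the extended valuation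
  gives \<open>v \<circ> \<sigma> = v\<close> (\<open>immediate_cyclic_extension_of_defect\<close>). Write \<open>\<Sigma>\<close> for the set of all
  \<open>v (\<delta> b / b)\<close>.

  \<^item> \<open>\<Sigma>\<close> is a final segment of the positive values without least element. One gets above a given
    \<open>v (\<delta> b)\<close>, where \<open>b\<close> is a unit, by passing to \<open>1 + d b\<close> with \<open>d \<in> K\<close>, and below it by passing
    to \<open>b - c\<close>, where \<open>c \<in> K\<close> has the same residue as \<open>b\<close> (\<open>S_upward\<close>, \<open>S_no_least\<close>).

  \<^item> For \<open>b \<notin> K\<close> the element \<open>x = b\<^bsup>p-1\<^esup> / \<Prod>(b - d)\<close>, with \<open>d\<close> running over the other conjugates
    of \<open>b\<close>, has trace \<open>1\<close> by Lagrange interpolation. All differences \<open>b - d\<close> have the value of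
    \<open>\<delta> b\<close>, since each non-trivial power of \<open>\<sigma>\<close> generates the Galois group; so
    \<open>v x = - (p - 1) v (\<delta> b / b)\<close>. Multiply by elements of \<open>K\<close>: as \<open>\<Sigma>\<close> has no least element,
    the traces of the maximal ideal include every \<open>c \<in> K\<close> with \<open>v c \<ge> (p - 1) s\<close> for some
    \<open>s \<in> \<Sigma>\<close> (\<open>Tr_trace_one\<close>, \<open>v_trace_one\<close>, \<open>trace_ideal_subset\<close>).

  \<^item> Conversely, \<open>\<delta>\<close> raises the value of each element by an element of \<open>\<Sigma>\<close>, and
    \<open>1 + \<sigma> + \<dots> + \<sigma>\<^bsup>p-1\<^esup>\<close> is congruent to \<open>\<delta>\<^bsup>p-1\<^esup>\<close> modulo \<open>p\<close>. If \<open>p \<noteq> 0\<close> in \<open>L\<close>, apply the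
    previous item to a Kummer generator \<open>\<eta>\<close>: then \<open>x\<close> lies in \<open>K\<close>, so \<open>p x = 1\<close> and \<open>v p\<close> is itself
    of the form \<open>(p - 1) s\<close> (\<open>v_p_ramification\<close>). Hence integral elements have traces of value at
    least \<open>(p - 1) s\<close> for some \<open>s \<in> \<Sigma>\<close> (\<open>Tr_vge\<close>).

  So the traces of the integral elements form the ideal of all \<open>c \<in> K\<close> with \<open>v c \<ge> (p - 1) s\<close> for
  some \<open>s \<in> \<Sigma>\<close>; since every value is attained on \<open>K\<close>, this is the power \<open>p - 1\<close> of the ideal of
  all \<open>c \<in> K\<close> with \<open>v c \<in> \<Sigma>\<close>.

  For the statements on independent defect, let \<open>H\<close> be strongly convex. The values above \<open>H\<close>
  have no least element modulo \<open>H\<close>, so below each of them there is some \<open>(p - 1) s\<close> with \<open>s\<close> above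
  \<open>H\<close>. Therefore \<open>\<Sigma>\<close> consists of the values above \<open>H\<close> precisely when the upward closure
  of \<open>(p - 1) \<Sigma>\<close> does, that is, when the trace ideal is the contraction of the maximal ideal of
  \<open>v\<^sub>H\<close> (\<open>S_eq_above_iff\<close>). In mixed characteristic \<open>v p = (p - 1) s\<close> then lies above \<open>H\<close>; this
  yields the residue characteristic of \<open>v\<^sub>H\<close>, and forces \<open>H = {0}\<close> as soon as the convex subgroup
  generated by \<open>v p\<close> is archimedean.
\<close>


section \<open>Linear systems and characters\<close>

text \<open>
  The classical argument for the independence of characters: subtracting \<open>f k y\<close> times the relation
  from the relation at \<open>y * x\<close> eliminates the term of \<open>k\<close>.
\<close>
lemma dedekind_independence:
  fixes f :: "'i \<Rightarrow> 'a::field \<Rightarrow> 'a"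
  assumes "finite J" "inj_on f J"
    and "\<And>j x y. j \<in> J \<Longrightarrow> f j (x * y) = f j x * f j y" "\<And>j. j \<in> J \<Longrightarrow> f j 1 = 1"
    and "\<And>x. (\<Sum>j\<in>J. w j * f j x) = 0"
  shows "\<forall>j\<in>J. w j = 0"
  using assms
proof (induction J arbitrary: w rule: finite_induct)
  case (insert k J)
  have sum_x: "w k * f k x + (\<Sum>j\<in>J. w j * f j x) = 0" for x
    using insert.prems(4)[of x] insert.hyps by simp
  have "(\<Sum>j\<in>J. (w j * (f j y - f k y)) * f j x) = 0" for x y
  proof -
    have 1: "w k * (f k y * f k x) + (\<Sum>j\<in>J. w j * (f j y * f j x)) = 0"
      using sum_x[of "y * x"] insert.prems(2) by simp
    have 2: "w k * (f k y * f k x) + (\<Sum>j\<in>J. w j * (f k y * f j x)) = 0"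
      using arg_cong[OF sum_x[of x], of "\<lambda>z. f k y * z"]
      by (simp add: distrib_left sum_distrib_left mult_ac)
    have "(\<Sum>j\<in>J. (w j * (f j y - f k y)) * f j x) =
        (\<Sum>j\<in>J. w j * (f j y * f j x)) - (\<Sum>j\<in>J. w j * (f k y * f j x))"
      by (simp add: sum_subtractf[symmetric] algebra_simps)
    moreover have "(\<Sum>j\<in>J. w j * (f j y * f j x)) = (\<Sum>j\<in>J. w j * (f k y * f j x))"
      using 1 2 by (simp only: add_eq_0_iff)
    ultimately show ?thesis by simp
  qed
  then have zero: "\<forall>j\<in>J. w j * (f j y - f k y) = 0" for y
    using insert.prems(1-3) by (intro insert.IH) (auto simp: inj_on_def)
  have w0: "w j = 0" if "j \<in> J" for j
  proof -
    have "f j \<noteq> f k" using insert.prems(1) insert.hyps that by (auto simp: inj_on_def)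
    then obtain y where "f j y \<noteq> f k y" by blast
    with zero[of y] that show ?thesis by auto
  qed
  with sum_x[of 1] insert.prems(3) show ?case by simp
qed simp

text \<open>
  Gaussian elimination: an equation with a nonzero coefficient at \<open>l\<close> is solved for the unknown \<open>l\<close>.
\<close>
lemma homogeneous_system_solution:
  fixes A :: "'i \<Rightarrow> 'j \<Rightarrow> 'a::field"
  assumes "finite I" "finite J" "card I < card J"
  shows "\<exists>w. (\<exists>j\<in>J. w j \<noteq> 0) \<and> (\<forall>i\<in>I. (\<Sum>j\<in>J. A i j * w j) = 0)"
  using assms
proof (induction I arbitrary: J A rule: finite_induct)
  case empty
  then show ?case by (intro exI[of _ "\<lambda>_. 1"]) (auto simp: card_gt_0_iff)
next
  case (insert k I)
  show ?case
  proof (cases "\<forall>j\<in>J. A k j = 0")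
    case True
    obtain w where "\<exists>j\<in>J. w j \<noteq> 0" "\<forall>i\<in>I. (\<Sum>j\<in>J. A i j * w j) = 0"
      using insert.IH[of J A] insert.prems insert.hyps by auto
    with True show ?thesis by (intro exI[of _ w]) auto
  next
    case False
    then obtain l where l: "l \<in> J" "A k l \<noteq> 0" by blast
    define B where "B i j = A i j - A i l * A k j / A k l" for i j
    have "card I < card (J - {l})" using insert.prems insert.hyps l by auto
    with insert.IH[of "J - {l}" B] insert.prems obtain w where
      w: "\<exists>j\<in>J - {l}. w j \<noteq> 0" "\<forall>i\<in>I. (\<Sum>j\<in>J - {l}. B i j * w j) = 0" by auto
    define t where "t = - (\<Sum>j\<in>J - {l}. A k j * w j) / A k l"
    define u where "u = w(l := t)"
    have sum_u: "(\<Sum>j\<in>J. A i j * u j) = A i l * t + (\<Sum>j\<in>J - {l}. A i j * w j)" for i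
    proof -
      have "(\<Sum>j\<in>J. A i j * u j) = A i l * u l + (\<Sum>j\<in>J - {l}. A i j * u j)"
        by (rule sum.remove) (use insert.prems l in auto)
      also have "(\<Sum>j\<in>J - {l}. A i j * u j) = (\<Sum>j\<in>J - {l}. A i j * w j)"
        by (rule sum.cong) (auto simp: u_def)
      finally show ?thesis by (simp add: u_def)
    qed
    have "(\<Sum>j\<in>J. A i j * u j) = 0" if "i \<in> I" for i
    proof -
      have "0 = (\<Sum>j\<in>J - {l}. A i j * w j) - A i l / A k l * (\<Sum>j\<in>J - {l}. A k j * w j)"
        using w(2) that
        by (simp add: B_def sum_distrib_left sum_subtractf[symmetric] algebra_simps)
      then show ?thesis by (simp add: sum_u t_def)
    qed
    moreover have "(\<Sum>j\<in>J. A k j * u j) = 0" using l by (simp add: sum_u t_def)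
    moreover have "\<exists>j\<in>J. u j \<noteq> 0" using w(1) by (auto simp: u_def)
    ultimately show ?thesis by (intro exI[of _ u]) auto
  qed
qed

text \<open>
  The columns of a right inverse come from the underdetermined homogeneous systems that have one
  additional unknown multiplying a unit vector. A right inverse is also a left inverse because the
  difference \<open>N M - 1\<close> is killed by \<open>M\<close>.
\<close>
lemma inverse_matrix_of_trivial_kernel:
  fixes M :: "nat \<Rightarrow> nat \<Rightarrow> 'a::field"
  assumes ker: "\<And>w. \<lbrakk>\<And>j. j < n \<Longrightarrow> (\<Sum>i<n. M j i * w i) = 0\<rbrakk> \<Longrightarrow> \<forall>i<n. w i = 0"
  obtains N where
    "\<And>j k. j < n \<Longrightarrow> k < n \<Longrightarrow> (\<Sum>i<n. M j i * N i k) = (if j = k then 1 else 0)"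
    "\<And>i l. i < n \<Longrightarrow> l < n \<Longrightarrow> (\<Sum>j<n. N i j * M j l) = (if i = l then 1 else 0)"
proof -
  have "\<exists>u. \<forall>j<n. (\<Sum>i<n. M j i * u i) = (if j = k then 1 else 0)" for k
  proof -
    define A where "A j i = (if i < n then M j i else if j = k then -1 else 0)" for j i
    obtain w where w: "\<exists>i\<in>{..<Suc n}. w i \<noteq> 0"
      "\<forall>j\<in>{..<n}. (\<Sum>i\<in>{..<Suc n}. A j i * w i) = 0"
      using homogeneous_system_solution[of "{..<n}" "{..<Suc n}" A] by auto
    have eq: "(\<Sum>i<n. M j i * w i) = (if j = k then w n else 0)" if "j < n" for j
    proof -
      have "(\<Sum>i<n. A j i * w i) + A j n * w n = 0" using w(2) that by simp
      then show ?thesis by (simp add: A_def add_eq_0_iff split: if_splits)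
    qed
    have "w n \<noteq> 0"
    proof
      assume "w n = 0"
      then have "\<forall>i<n. w i = 0" using eq by (intro ker) auto
      with w(1) \<open>w n = 0\<close> show False by (auto simp: less_Suc_eq)
    qed
    then have "\<forall>j<n. (\<Sum>i<n. M j i * (w i / w n)) = (if j = k then 1 else 0)"
      using eq by (simp add: sum_divide_distrib[symmetric])
    then show ?thesis by (rule exI[of _ "\<lambda>i. w i / w n"])
  qed
  then obtain u where u: "\<And>k j. j < n \<Longrightarrow> (\<Sum>i<n. M j i * u k i) = (if j = k then 1 else 0)"
    by metis
  have "\<forall>i<n. (\<Sum>j<n. u j i * M j l) - (if i = l then 1 else 0) = 0" if l: "l < n" for l
  proof (rule ker)
    fix k assume k: "k < n"
    have "(\<Sum>i<n. M k i * ((\<Sum>j<n. u j i * M j l) - (if i = l then 1 else 0))) =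
      (\<Sum>i<n. \<Sum>j<n. M k i * u j i * M j l) - (\<Sum>i<n. if i = l then M k i else 0)"
      by (simp add: right_diff_distrib sum_subtractf sum_distrib_left mult_ac if_distrib[of "times _"] cong: if_cong)
    also have "(\<Sum>i<n. \<Sum>j<n. M k i * u j i * M j l) = (\<Sum>j<n. (\<Sum>i<n. M k i * u j i) * M j l)"
      by (subst sum.swap) (simp add: sum_distrib_right)
    also have "\<dots> = (\<Sum>j<n. if k = j then M j l else 0)"
      using k by (intro sum.cong) (auto simp: u)
    finally show "(\<Sum>i<n. M k i * ((\<Sum>j<n. u j i * M j l) - (if i = l then 1 else 0))) = 0"
      using k l by simp
  qed
  then show thesis using that[of "\<lambda>i k. u k i"] u by auto
qed

section \<open>Two identities behind the trace estimates\<close>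

text \<open>
  The sum is the coefficient of \<open>X\<^bsup>n-1\<^esup>\<close> in the polynomial of degree less than \<open>n = card C\<close> that
  interpolates \<open>X\<^bsup>n-1\<^esup>\<close> on \<open>C\<close>, and that polynomial is \<open>X\<^bsup>n-1\<^esup>\<close> itself.
\<close>
lemma lagrange_top_coefficient:
  fixes C :: "'a::field set"
  assumes "finite C" "C \<noteq> {}"
  shows "(\<Sum>c\<in>C. c ^ (card C - 1) / (\<Prod>d\<in>C - {c}. c - d)) = 1"
proof -
  let ?n = "card C"
  define q where "q c = (\<Prod>d\<in>C - {c}. [:- d, 1:])" for c
  define P where "P = (\<Sum>c\<in>C. smult (c ^ (?n - 1) / (\<Prod>d\<in>C - {c}. c - d)) (q c))"
  have n: "?n > 0" using assms by (simp add: card_gt_0_iff)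
  have deg_q: "degree (q c) = ?n - 1" "coeff (q c) (?n - 1) = 1" if "c \<in> C" for c
  proof -
    have "degree (q c) = (\<Sum>d\<in>C - {c}. degree [:- d, 1:])"
      unfolding q_def by (rule degree_prod_eq_sum_degree) auto
    then show deg: "degree (q c) = ?n - 1" using assms that by simp
    have "lead_coeff (q c) = 1" unfolding q_def by (simp add: lead_coeff_prod)
    then show "coeff (q c) (?n - 1) = 1" using deg by simp
  qed
  have "P = monom 1 (?n - 1)"
  proof (rule poly_eqI_degree[of C])
    have "degree P \<le> ?n - 1" unfolding P_def
      by (rule degree_sum_le) (use assms deg_q in \<open>auto intro: order.trans[OF degree_smult_le]\<close>)
    then show "degree P < ?n" using n by simp
    show "degree (monom (1::'a) (?n - 1)) < ?n" using n by (simp add: degree_monom_eq)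
    fix x assume x: "x \<in> C"
    have q_x: "poly (q c) x = (if c = x then \<Prod>d\<in>C - {x}. x - d else 0)" if "c \<in> C" for c
      using assms(1) x by (auto simp: q_def poly_prod intro!: prod_zero)
    have "poly P x = (\<Sum>c\<in>C. c ^ (?n - 1) / (\<Prod>d\<in>C - {c}. c - d) * poly (q c) x)"
      by (simp add: P_def poly_sum)
    also have "\<dots> = (\<Sum>c\<in>C. if c = x then c ^ (?n - 1) else 0)"
      using assms(1) by (intro sum.cong) (auto simp: q_x)
    also have "\<dots> = x ^ (?n - 1)" using assms(1) x by simp
    finally show "poly P x = poly (monom 1 (?n - 1)) x" by (simp add: poly_monom)
  qed
  then have "coeff P (?n - 1) = 1" by simp
  moreover have "coeff P (?n - 1) = (\<Sum>c\<in>C. c ^ (?n - 1) / (\<Prod>d\<in>C - {c}. c - d))"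
    unfolding P_def coeff_sum by (intro sum.cong refl) (simp only: coeff_smult deg_q mult_1_right)
  ultimately show ?thesis by simp
qed

text \<open>
  Neighbouring binomial coefficients in the row \<open>p - 1\<close> add up to a multiple of \<open>p\<close>. This is the
  congruence \<open>(X - 1)\<^bsup>p-1\<^esup> = 1 + X + \<dots> + X\<^bsup>p-1\<^esup>\<close> modulo \<open>p\<close>.
\<close>
lemma choose_prime_minus_one_cong:
  fixes p :: nat
  assumes "Factorial_Ring.prime p" "j < p"
  shows "int p dvd (-1) ^ (p - 1 + j) * int ((p - 1) choose j) - 1"
  using assms(2)
proof (induction j)
  case 0
  show ?case
  proof (cases "p = 2")
    case False
    then have "even (p - 1)" using prime_odd_nat[OF assms(1)] prime_gt_1_nat[OF assms(1)] by auto
    then show ?thesis by simp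
  qed simp
next
  case (Suc j)
  have "(p choose Suc j) = ((p - 1) choose j) + ((p - 1) choose Suc j)"
    using binomial_Suc_Suc[of "p - 1" j] prime_gt_0_nat[OF assms(1)] by simp
  moreover have "p dvd (p choose Suc j)"
    by (rule dvd_choose_prime) (use Suc assms in auto)
  ultimately have "int p dvd int ((p - 1) choose j) + int ((p - 1) choose Suc j)"
    by (metis of_nat_add of_nat_dvd_iff)
  then have "int p dvd (-1) ^ (p - 1 + j) * (int ((p - 1) choose j) + int ((p - 1) choose Suc j))"
    by (rule dvd_mult)
  from dvd_diff[OF Suc.IH this] Suc.prems have "int p dvd ((-1) ^ (p - 1 + j) * int ((p - 1) choose j) - 1) -
      (-1) ^ (p - 1 + j) * (int ((p - 1) choose j) + int ((p - 1) choose Suc j))"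
    by simp
  moreover have "\<dots> = (-1) ^ (p - 1 + Suc j) * int ((p - 1) choose Suc j) - 1"
    by (simp add: algebra_simps)
  ultimately show ?case by (simp only:)
qed

section \<open>Subrings and subfields of a field\<close>

lemma record_simps [simp]:
  "carrier (ring_of_type_algebra :: 'a::field ring) = UNIV"
  "x \<otimes>\<^bsub>(ring_of_type_algebra :: 'a::field ring)\<^esub> y = x * y"
  "x \<oplus>\<^bsub>(ring_of_type_algebra :: 'a::field ring)\<^esub> y = x + y"
  "\<one>\<^bsub>(ring_of_type_algebra :: 'a::field ring)\<^esub> = 1"
  "\<zero>\<^bsub>(ring_of_type_algebra :: 'a::field ring)\<^esub> = 0"
  by (simp_all add: ring_of_type_algebra_def)

interpretation type_ring: Ring.ring "ring_of_type_algebra :: 'a::field ring"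
  by (rule ring_from_type_algebra)

lemma a_minus_record [simp]: "\<ominus>\<^bsub>(ring_of_type_algebra :: 'a::field ring)\<^esub> x = - x"
  using type_ring.l_neg[of x] by (simp add: eq_neg_iff_add_eq_0)

lemma m_inv_record [simp]:
  "x \<noteq> 0 \<Longrightarrow> inv\<^bsub>(ring_of_type_algebra :: 'a::field ring)\<^esub> x = inverse x"
  using comm_monoid.comm_inv_char[OF cring.axioms(2)[OF cring_from_type_algebra], of x "inverse x"] by simp

lemma combine_record:
  "length cs = length B \<Longrightarrow>
    ring.combine (ring_of_type_algebra :: 'a::field ring) cs B = (\<Sum>i<length B. cs ! i * B ! i)"
  by (induction cs B rule: list_induct2) (simp_all add: sum.lessThan_Suc_shift del: sum.lessThan_Suc)

lemma subfield_record_closed: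
  assumes "subfield K (ring_of_type_algebra :: 'a::field ring)"
  shows "0 \<in> K" "1 \<in> K" "\<And>x y. x \<in> K \<Longrightarrow> y \<in> K \<Longrightarrow> x + y \<in> K"
    "\<And>x y. x \<in> K \<Longrightarrow> y \<in> K \<Longrightarrow> x * y \<in> K" "\<And>x. x \<in> K \<Longrightarrow> - x \<in> K"
    "\<And>x. x \<in> K \<Longrightarrow> inverse x \<in> K"
proof -
  note sr = subringE[OF subfieldE(1)[OF assms]]
  show "0 \<in> K" "1 \<in> K" "\<And>x y. x \<in> K \<Longrightarrow> y \<in> K \<Longrightarrow> x + y \<in> K"
    "\<And>x y. x \<in> K \<Longrightarrow> y \<in> K \<Longrightarrow> x * y \<in> K" "\<And>x. x \<in> K \<Longrightarrow> - x \<in> K"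
    using sr(2,3,5-7) by simp_all
  show "inverse x \<in> K" if "x \<in> K" for x
    using type_ring.subfield_m_inv(1)[OF assms, of x] that \<open>0 \<in> K\<close> by (cases "x = 0") auto
qed

lemma subfield_recordI:
  assumes "0 \<in> K" "1 \<in> K" "\<And>x y. x \<in> K \<Longrightarrow> y \<in> K \<Longrightarrow> x + y \<in> K"
    "\<And>x y. x \<in> K \<Longrightarrow> y \<in> K \<Longrightarrow> x * y \<in> K" "\<And>x. x \<in> K \<Longrightarrow> - x \<in> K"
    "\<And>x. x \<in> K \<Longrightarrow> inverse x \<in> K"
  shows "subfield K (ring_of_type_algebra :: 'a::field ring)"
proof (rule field.subfieldI'[OF field_from_type_algebra])
  show "subring K ring_of_type_algebra"
    by (rule type_ring.subringI) (use assms in auto)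
qed (use assms in auto)

lemma (in ring) dimension_one_eq:
  assumes K: "subfield K R" and "dimension 1 K E" "\<one> \<in> E" "\<one> \<noteq> \<zero>"
  shows "E = K"
proof -
  have ind: "independent K [\<one>]" using assms(4) by (intro li_Cons) auto
  have "Span K [\<one>] = E" 
    using independent_length_eq_dimension[OF K assms(2) ind] assms(3) by auto
  moreover have "Span K [\<one>] = K" 
    using independent_length_eq_dimension[OF K dimension_one[OF K] ind]
      subringE(3)[OF subfieldE(1)[OF K]] by auto
  ultimately show ?thesis by simp
qed

lemma dimension_of_ext_degree:
  assumes "ring R" "subfield K R" "ext_degree R K > 0"
  shows "ring.dimension R (ext_degree R K) K (carrier R)"
proof -
  interpret ring R by fact
  show ?thesis
    using assms(3) finite_dimensionE[OF assms(2), of "carrier R"]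
    by (auto simp: ext_degree_def over_def split: if_splits)
qed

text \<open>
  By the tower law the degree of \<open>F\<close> over \<open>K\<close> divides a prime.
\<close>
lemma prime_degree_no_intermediate:
  fixes K F :: "'a::field set"
  assumes K: "subfield K ring_of_type_algebra" and F: "subfield F ring_of_type_algebra"
    and deg: "Factorial_Ring.prime (ext_degree (ring_of_type_algebra :: 'a ring) K)"
    and "K \<subseteq> F" "F \<noteq> UNIV"
  shows "F = K"
proof -
  let ?R = "ring_of_type_algebra :: 'a ring"
  let ?p = "ext_degree ?R K"
  have dim: "type_ring.dimension ?p K UNIV"
    using dimension_of_ext_degree[OF type_ring.ring_axioms K] prime_gt_0_nat[OF deg] by simp
  have "subalgebra K F ?R"
  proof -
    have "subgroup F (add_monoid ?R)"
      using subringE(1)[OF subfieldE(1)[OF F]] subring.axioms(1)[OF subfieldE(1)[OF F]] by simp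
    then show ?thesis using \<open>K \<subseteq> F\<close> subfield_record_closed[OF F]
      by (auto simp: subalgebra_def subalgebra_axioms_def)
  qed
  then have fin_KF: "type_ring.finite_dimension K F"
    using type_ring.subalbegra_incl_imp_finite_dimension[OF K, of UNIV F] dim
    by (auto simp: type_ring.finite_dimension_def)
  obtain B where B: "type_ring.Span K B = UNIV"
    using type_ring.exists_base[OF K dim] by auto
  have "type_ring.Span K B \<subseteq> type_ring.Span F B"
    using \<open>K \<subseteq> F\<close> by (auto simp: type_ring.Span_eq_combine_set[OF K] type_ring.Span_eq_combine_set[OF F] simp del: type_ring.Span.simps)
  then have fin_FL: "type_ring.finite_dimension F UNIV"
    using type_ring.Span_finite_dimension[OF F, of B] B by (simp del: type_ring.Span.simps add: top.extremum_unique)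
  let ?n = "type_ring.dim K F" and ?m = "type_ring.dim F UNIV"
  have n: "type_ring.dimension ?n K F" and m: "type_ring.dimension ?m F UNIV"
    using type_ring.finite_dimensionE[OF K fin_KF] type_ring.finite_dimensionE[OF F fin_FL]
    by (simp_all add: over_def)
  have "?p = ?n * ?m"
    by (rule type_ring.dimension_is_inj[OF K dim type_ring.telescopic_base[OF K F n m]])
  then have "?n = 1 \<or> ?m = 1" using deg by (metis prime_product)
  moreover have "?m \<noteq> 1"
    using type_ring.dimension_one_eq[OF F, of UNIV] m \<open>F \<noteq> UNIV\<close> by auto
  ultimately show ?thesis
    using type_ring.dimension_one_eq[OF K, of F] n subfield_record_closed(2)[OF F] by auto
qed

lemma subring_recordI:
  assumes "1 \<in> A" "\<And>x y. x \<in> A \<Longrightarrow> y \<in> A \<Longrightarrow> x + y \<in> A"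
    "\<And>x y. x \<in> A \<Longrightarrow> y \<in> A \<Longrightarrow> x * y \<in> A" "\<And>x. x \<in> A \<Longrightarrow> - x \<in> A"
  shows "subring A (ring_of_type_algebra :: 'a::field ring)"
  by (rule type_ring.subringI) (use assms in auto)

lemma subring_record_closed:
  assumes "subring A (ring_of_type_algebra :: 'a::field ring)"
  shows "0 \<in> A" "1 \<in> A" "\<And>x y. x \<in> A \<Longrightarrow> y \<in> A \<Longrightarrow> x + y \<in> A"
    "\<And>x y. x \<in> A \<Longrightarrow> y \<in> A \<Longrightarrow> x * y \<in> A" "\<And>x. x \<in> A \<Longrightarrow> - x \<in> A"
  using subringE(2,3,5-7)[OF assms] by simp_all

lemma cring_ring_on:
  assumes "subring A (ring_of_type_algebra :: 'a::field ring)"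
  shows "cring (ring_on A)"
  using type_ring.subcring_iff[of A] cring.subcringI'[OF cring_from_type_algebra assms] by simp

lemma a_minus_ring_on:
  assumes "subring A (ring_of_type_algebra :: 'a::field ring)" "x \<in> A"
  shows "\<ominus>\<^bsub>ring_on A\<^esub> x = - x"
proof -
  interpret cring "ring_on A" by (rule cring_ring_on[OF assms(1)])
  show ?thesis
    by (rule minus_equality) (use assms subring_record_closed[OF assms(1)] in auto)
qed

lemma ideal_ring_onI:
  assumes A: "subring A (ring_of_type_algebra :: 'a::field ring)"
    and "I \<subseteq> A" "0 \<in> I" "\<And>x y. x \<in> I \<Longrightarrow> y \<in> I \<Longrightarrow> x + y \<in> I"
    and mult: "\<And>x y. x \<in> A \<Longrightarrow> y \<in> I \<Longrightarrow> x * y \<in> I"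
  shows "ideal I (ring_on A)"
proof -
  interpret cring "ring_on A" by (rule cring_ring_on[OF A])
  have neg: "- x \<in> I" if "x \<in> I" for x
    using mult[of "- 1" x] that subring_record_closed[OF A] by simp
  show ?thesis
  proof (rule idealI)
    show "subgroup I (add_monoid (ring_on A))"
      by (rule add.subgroupI) (use assms neg a_minus_ring_on[OF A] in \<open>auto simp: subset_iff\<close>)
    show "a \<otimes>\<^bsub>ring_on A\<^esub> x \<in> I" if "a \<in> I" "x \<in> carrier (ring_on A)" for a x
      using mult[of x a] that by (simp add: mult.commute)
  qed (use mult ring_axioms in auto)
qed

lemma ideal_ring_onD:
  assumes "ideal I (ring_on A)"
  shows "I \<subseteq> A" "0 \<in> I" "\<And>x y. x \<in> I \<Longrightarrow> y \<in> I \<Longrightarrow> x + y \<in> I"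
    "\<And>x y. x \<in> A \<Longrightarrow> y \<in> I \<Longrightarrow> x * y \<in> I"
proof -
  interpret ideal I "ring_on A" by fact
  show "I \<subseteq> A" "0 \<in> I" "\<And>x y. x \<in> I \<Longrightarrow> y \<in> I \<Longrightarrow> x + y \<in> I"
    "\<And>x y. x \<in> A \<Longrightarrow> y \<in> I \<Longrightarrow> x * y \<in> I"
    using Icarr additive_subgroup.a_closed[OF is_additive_subgroup] I_l_closed
      additive_subgroup.zero_closed[OF is_additive_subgroup] by auto
qed

lemma genideal_ring_on_eq:
  assumes "ideal I (ring_on A)" "G \<subseteq> I" "\<And>J. ideal J (ring_on A) \<Longrightarrow> G \<subseteq> J \<Longrightarrow> I \<subseteq> J"
  shows "Idl\<^bsub>ring_on A\<^esub> G = I"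
  using assms unfolding genideal_def by blast

lemma coset_eq_iff:
  assumes A: "subring A (ring_of_type_algebra :: 'a::field ring)" and I: "ideal I (ring_on A)"
    and "x \<in> A" "y \<in> A"
  shows "I +>\<^bsub>ring_on A\<^esub> x = I +>\<^bsub>ring_on A\<^esub> y \<longleftrightarrow> x - y \<in> I"
proof -
  interpret cring "ring_on A" by (rule cring_ring_on[OF A])
  show ?thesis
    using quotient_eq_iff_same_a_r_cos[OF I, of x y] assms a_minus_ring_on[OF A, of y]
    by (simp add: a_minus_def)
qed

text \<open>
  The \<open>n\<close>-fold sum of the unit of the quotient is the coset of \<open>n\<close>.
\<close>
lemma ring_char_quotient:
  assumes A: "subring A (ring_of_type_algebra :: 'a::field ring)" and I: "ideal I (ring_on A)"
  shows "ring_char (ring_on A Quot I) = Gcd {n. of_nat n \<in> I}"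
proof -
  interpret I: ideal I "ring_on A" by (rule I)
  interpret h: ring_hom_ring "ring_on A" "ring_on A Quot I" "(+>\<^bsub>ring_on A\<^esub>) I"
    by (rule I.rcos_ring_hom_ring)
  have nat_A: "of_nat n \<in> A" for n
    by (induction n) (use subring_record_closed[OF A] in auto)
  have one: "\<one>\<^bsub>ring_on A Quot I\<^esub> = I +>\<^bsub>ring_on A\<^esub> 1" and zero: "\<zero>\<^bsub>ring_on A Quot I\<^esub> = I +>\<^bsub>ring_on A\<^esub> 0"
    using h.hom_one h.hom_zero by simp_all
  have pow: "add_pow (ring_on A Quot I) n \<one>\<^bsub>ring_on A Quot I\<^esub> = I +>\<^bsub>ring_on A\<^esub> of_nat n" for n :: nat
  proof (induction n)
    case 0
    then show ?case using zero by simp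
  next
    case (Suc n)
    have "I +>\<^bsub>ring_on A\<^esub> (of_nat n + 1) =
        (I +>\<^bsub>ring_on A\<^esub> of_nat n) \<oplus>\<^bsub>ring_on A Quot I\<^esub> (I +>\<^bsub>ring_on A\<^esub> 1)"
      using h.hom_add[of "of_nat n" 1] nat_A subring_record_closed[OF A] by simp
    then show ?case using Suc one by (simp add: add.commute)
  qed
  show ?thesis
    unfolding ring_char_def pow zero
    using coset_eq_iff[OF A I nat_A subring_record_closed(1)[OF A]] by simp
qed

section \<open>Galois extensions of prime degree\<close>

locale prime_cyclic_extension =
  fixes K :: "'a::field set" and \<sigma> :: "'a \<Rightarrow> 'a" and p :: nat
  assumes subfield_K: "subfield K ring_of_type_algebra"
    and prime_p: "Factorial_Ring.prime p"
    and degree: "ext_degree (ring_of_type_algebra :: 'a ring) K = p"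
    and galois: "\<sigma> \<in> galois_group K"
    and nontrivial: "\<sigma> \<noteq> id"
begin

lemmas K_closed = subfield_record_closed[OF subfield_K]

lemma K_divide: "x \<in> K \<Longrightarrow> y \<in> K \<Longrightarrow> x / y \<in> K"
  using K_closed(4)[of x "inverse y"] K_closed(6) by (simp add: field_simps)

lemma K_power: "x \<in> K \<Longrightarrow> x ^ n \<in> K"
  by (induction n) (auto intro: K_closed)

lemma p_gt_1: "p > 1" and p_pos: "p > 0"
  using prime_gt_1_nat[OF prime_p] by simp_all

definition conjugate :: "nat \<Rightarrow> 'a \<Rightarrow> 'a" where "conjugate j = \<sigma> ^^ j"

lemma conjugate_0 [simp]: "conjugate 0 x = x" and conjugate_1 [simp]: "conjugate (Suc 0) x = \<sigma> x"
  and conjugate_Suc: "conjugate (Suc j) x = \<sigma> (conjugate j x)" and conjugate_add: "conjugate (i + j) x = conjugate i (conjugate j x)"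
  by (simp_all add: conjugate_def funpow_add)

lemma \<sigma>_add: "\<sigma> (x + y) = \<sigma> x + \<sigma> y" and \<sigma>_mult: "\<sigma> (x * y) = \<sigma> x * \<sigma> y"
  and \<sigma>_1: "\<sigma> 1 = 1" and bij_\<sigma>: "bij \<sigma>" and \<sigma>_K: "x \<in> K \<Longrightarrow> \<sigma> x = x"
  using galois by (auto simp: galois_group_def ring_iso_def ring_hom_def)

lemma conjugate_mult: "conjugate j (x * y) = conjugate j x * conjugate j y"
  and conjugate_add_distrib: "conjugate j (x + y) = conjugate j x + conjugate j y" and conjugate_one: "conjugate j 1 = 1"
  and conjugate_K: "x \<in> K \<Longrightarrow> conjugate j x = x"
  by (induction j) (simp_all add: conjugate_Suc \<sigma>_add \<sigma>_mult \<sigma>_1 \<sigma>_K)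

lemma conjugate_zero [simp]: "conjugate j 0 = 0"
  using conjugate_K K_closed(1) by blast

lemma conjugate_uminus: "conjugate j (- x) = - conjugate j x"
  using conjugate_add_distrib[of j x "- x"] by (simp add: eq_neg_iff_add_eq_0 add.commute)

lemma conjugate_diff: "conjugate j (x - y) = conjugate j x - conjugate j y"
  using conjugate_add_distrib[of j x "- y"] by (simp add: conjugate_uminus)

lemma bij_conj: "bij (conjugate j)"
  unfolding conjugate_def by (rule bij_fn[OF bij_\<sigma>])

lemma conjugate_eq_iff [simp]: "conjugate j x = conjugate j y \<longleftrightarrow> x = y"
  using bij_conj[of j] by (auto simp: bij_def inj_on_def)

lemma conjugate_eq_0_iff [simp]: "conjugate j x = 0 \<longleftrightarrow> x = 0"
  using conjugate_eq_iff[of j x 0] by simp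

lemma conjugate_inverse: "conjugate j (inverse x) = inverse (conjugate j x)"
proof (cases "x = 0")
  case False
  then have "conjugate j x * conjugate j (inverse x) = 1" by (simp add: conjugate_mult[symmetric] conjugate_one)
  then show ?thesis by (rule inverse_unique[symmetric])
qed simp

lemma conjugate_divide: "conjugate j (x / y) = conjugate j x / conjugate j y"
  by (simp add: divide_inverse conjugate_mult conjugate_inverse)

lemma conjugate_power: "conjugate j (x ^ n) = conjugate j x ^ n"
  by (induction n) (simp_all add: conjugate_one conjugate_mult)

lemma conjugate_sum: "conjugate j (sum f A) = (\<Sum>a\<in>A. conjugate j (f a))"
  by (induction A rule: infinite_finite_induct) (simp_all add: conjugate_add_distrib)

lemma conjugate_prod: "conjugate j (prod f A) = (\<Prod>a\<in>A. conjugate j (f a))"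
  by (induction A rule: infinite_finite_induct) (simp_all add: conjugate_one conjugate_mult)

text \<open>
  The fixed field of \<open>\<sigma>\<close> is an intermediate field different from \<open>L\<close>.
\<close>
lemma fixed_iff: "\<sigma> x = x \<longleftrightarrow> x \<in> K"
proof -
  let ?F = "{x. \<sigma> x = x}"
  note rules = conjugate_add_distrib[of "Suc 0"] conjugate_mult[of "Suc 0"] conjugate_one[of "Suc 0"] conjugate_uminus[of "Suc 0"]
    conjugate_inverse[of "Suc 0"] conjugate_zero[of "Suc 0", unfolded conjugate_1]
  have "subfield ?F ring_of_type_algebra"
    by (rule subfield_recordI) (use rules in auto)
  moreover have "?F \<noteq> UNIV" using nontrivial by (auto simp: fun_eq_iff)
  ultimately have "?F = K"
    using prime_degree_no_intermediate[OF subfield_K, of ?F] prime_p degree \<sigma>_K by auto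
  then show ?thesis by auto
qed

lemma conjugate_independent:
  assumes "finite J" "inj_on conjugate J" "\<And>x. (\<Sum>j\<in>J. w j * conjugate j x) = 0"
  shows "\<forall>j\<in>J. w j = 0"
  using dedekind_independence[of J conjugate w] assms conjugate_mult conjugate_one by auto

lemma is_basisE:
  assumes "is_basis K B"
  shows "length B = p"
    "\<And>x. set (coords K B x) \<subseteq> K \<and> length (coords K B x) = p \<and> (\<Sum>i<p. coords K B x ! i * B ! i) = x"
    "\<And>c. \<lbrakk>\<And>i. i < p \<Longrightarrow> c i \<in> K; (\<Sum>i<p. c i * B ! i) = 0\<rbrakk> \<Longrightarrow> \<forall>i<p. c i = 0"
proof -
  have ind: "type_ring.independent K B" and span: "type_ring.Span K B = UNIV"
    using assms by (auto simp: is_basis_def)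
  have dim: "type_ring.dimension p K UNIV"
    using dimension_of_ext_degree[OF ring_from_type_algebra subfield_K] degree p_pos by simp
  show len: "length B = p"
    using type_ring.dimension_is_inj[OF subfield_K type_ring.dimensionI[OF subfield_K ind span] dim] .
  have ex1: "\<exists>!cs. set cs \<subseteq> K \<and> length cs = length B \<and> x = type_ring.combine cs B" for x
    using type_ring.unique_decomposition[OF subfield_K ind, of x] span by blast
  then have "\<exists>!cs. set cs \<subseteq> K \<and> length cs = length B \<and> type_ring.combine cs B = x" for x
    by (simp add: eq_commute)
  then have "set (coords K B x) \<subseteq> K \<and> length (coords K B x) = length B \<and>
      type_ring.combine (coords K B x) B = x" for x
    unfolding coords_def by (rule theI')
  then show "set (coords K B x) \<subseteq> K \<and> length (coords K B x) = p \<and>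
      (\<Sum>i<p. coords K B x ! i * B ! i) = x" for x
    using len by (metis combine_record)
  show "\<forall>i<p. c i = 0" if "\<And>i. i < p \<Longrightarrow> c i \<in> K" "(\<Sum>i<p. c i * B ! i) = 0" for c
  proof -
    have "map c [0..<p] = replicate p 0"
    proof -
      let ?P = "\<lambda>cs. set cs \<subseteq> K \<and> length cs = length B \<and> 0 = type_ring.combine cs B"
      have "?P (map c [0..<p])" using that len by (auto simp: combine_record)
      moreover have "?P (replicate p 0)" using K_closed(1) len by (auto simp: combine_record)
      ultimately show ?thesis using ex1[of 0] by blast
    qed
    then show ?thesis by (simp add: list_eq_iff_nth_eq)
  qed
qed

lemma basis_exists: "\<exists>B. is_basis K B"
proof -
  have "type_ring.dimension p K UNIV"
    using dimension_of_ext_degree[OF ring_from_type_algebra subfield_K] degree p_pos by simp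
  from type_ring.exists_base[OF subfield_K this] show ?thesis by (auto simp: is_basis_def)
qed

lemma cyclic_sum:
  assumes "f m = f 0" "m > 0"
  shows "(\<Sum>j<m. f (Suc j)) = (\<Sum>j<m. f j :: 'b::ab_group_add)"
proof -
  have "f 0 + (\<Sum>j<m. f (Suc j)) = (\<Sum>j<m. f j) + f m"
    using sum.lessThan_Suc_shift[of f m] sum.lessThan_Suc[of f m] by simp
  then show ?thesis using assms by (simp add: add.commute)
qed

text \<open>
  This gives at once that \<open>\<sigma>\<close> has order at least \<open>p\<close> and that the matrix of the conjugates of a basis
  is invertible. Let \<open>T\<close> be the sum of the powers of \<open>\<sigma>\<close>; its values are in \<open>K\<close>. Applying powers of
  \<open>\<sigma>\<close> to the equations for \<open>w\<close> moves \<open>\<sigma>\<close> from the basis elements to the coefficients, and summing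
  the results yields a \<open>K\<close>-linear relation between the basis elements, whose coefficients
  \<open>T (y * w i)\<close> must vanish for all \<open>y\<close>. By independence of characters \<open>T\<close> is not zero, so \<open>w = 0\<close>.
\<close>
lemma conjugates_kernel_trivial:
  assumes m: "m > 0" "conjugate m = id" "inj_on conjugate {..<m}"
    and B: "is_basis K B"
    and w: "\<And>j. j < m \<Longrightarrow> (\<Sum>i<p. conjugate j (B ! i) * w i) = 0"
  shows "\<forall>i<p. w i = 0"
proof (rule ccontr)
  assume "\<not> ?thesis"
  then obtain k where k: "k < p" "w k \<noteq> 0" by auto
  define T where "T x = (\<Sum>j<m. conjugate j x)" for x
  have T_K: "T x \<in> K" for x
  proof -
    have "\<sigma> (T x) = (\<Sum>j<m. conjugate (Suc j) x)"
      using conjugate_sum[of 1 "\<lambda>j. conjugate j x" "{..<m}"] by (simp add: T_def conjugate_Suc)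
    also have "\<dots> = T x" unfolding T_def by (rule cyclic_sum) (use m in auto)
    finally show ?thesis by (simp add: fixed_iff)
  qed
  have "T (y * w k) = 0" for y
  proof -
    \<comment> \<open>Apply \<open>\<sigma>\<^sup>j\<close> to the equation of index \<open>m - j\<close>, which for \<open>j = 0\<close> is the one of index \<open>0\<close>.\<close>
    have shifted: "(\<Sum>i<p. B ! i * conjugate j (y * w i)) = 0" if "j < m" for j
    proof -
      have "(\<Sum>i<p. conjugate ((m - j) mod m) (B ! i) * w i) = 0" using w m by simp
      moreover have "conjugate ((m - j) mod m) = conjugate (m - j)" using m that by (cases "j = 0") auto
      ultimately have "conjugate j (y * (\<Sum>i<p. conjugate (m - j) (B ! i) * w i)) = 0" by simp
      moreover have "conjugate j (conjugate (m - j) x) = x" for x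
        using conjugate_add[of j "m - j" x] that m by simp
      ultimately show ?thesis
        by (simp add: conjugate_sum conjugate_mult sum_distrib_left mult_ac)
    qed
    have "(\<Sum>i<p. T (y * w i) * B ! i) = (\<Sum>j<m. \<Sum>i<p. B ! i * conjugate j (y * w i))"
      unfolding T_def by (subst sum.swap) (simp add: sum_distrib_left mult.commute)
    then have "(\<Sum>i<p. T (y * w i) * B ! i) = 0" using shifted by simp
    then have "\<forall>i<p. T (y * w i) = 0" by (intro is_basisE(3)[OF B] T_K)
    then show ?thesis using k(1) by blast
  qed
  from this[of "x / w k" for x] have "(\<Sum>j\<in>{..<m}. 1 * conjugate j x) = 0" for x
    using k(2) by (simp add: T_def)
  then have "\<forall>j\<in>{..<m}. (1::'a) = 0" by (intro conjugate_independent) (use m in auto)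
  then show False using m(1) by auto
qed

text \<open>
  The order is at most \<open>p\<close>: otherwise \<open>p + 1\<close> characters, restricted to the \<open>p\<close> elements of a basis,
  would satisfy a linear relation, which extends to \<open>L\<close> by linearity. It is at least \<open>p\<close>: fewer
  conjugates would leave a nontrivial solution \<open>w\<close> for \<open>conjugates_kernel_trivial\<close>.
\<close>
lemma order_p: "conjugate p = id" and conjugate_inj: "inj_on conjugate {..<p}"
proof -
  obtain B where B: "is_basis K B" using basis_exists by blast
  have "\<not> inj_on conjugate {..<Suc p}"
  proof
    assume inj: "inj_on conjugate {..<Suc p}"
    obtain w where w: "\<exists>j\<in>{..<Suc p}. w j \<noteq> 0"
      "\<forall>i\<in>{..<p}. (\<Sum>j\<in>{..<Suc p}. conjugate j (B ! i) * w j) = 0"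
      using homogeneous_system_solution[of "{..<p}" "{..<Suc p}" "\<lambda>i j. conjugate j (B ! i)"] by auto
    have "(\<Sum>j\<in>{..<Suc p}. w j * conjugate j x) = 0" for x
    proof -
      let ?c = "coords K B x"
      have c: "set ?c \<subseteq> K" "length ?c = p" "x = (\<Sum>i<p. ?c ! i * B ! i)"
        using is_basisE(2)[OF B, of x] by auto
      have cK: "conjugate j (?c ! i) = ?c ! i" if "i < p" for i j
        using c(1,2) that by (intro conjugate_K) auto
      have "(\<Sum>j\<in>{..<Suc p}. w j * conjugate j x) =
          (\<Sum>j\<in>{..<Suc p}. \<Sum>i<p. ?c ! i * (conjugate j (B ! i) * w j))"
        by (subst (1) c(3)) (auto simp: conjugate_sum conjugate_mult cK sum_distrib_left mult_ac
            simp del: sum.lessThan_Suc intro!: sum.cong)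
      also have "\<dots> = (\<Sum>i<p. ?c ! i * (\<Sum>j\<in>{..<Suc p}. conjugate j (B ! i) * w j))"
        by (subst sum.swap) (simp add: sum_distrib_left del: sum.lessThan_Suc)
      also have "\<dots> = 0" using w(2) by (simp del: sum.lessThan_Suc)
      finally show ?thesis .
    qed
    then have "\<forall>j\<in>{..<Suc p}. w j = 0" by (intro conjugate_independent inj) auto
    with w(1) show False by blast
  qed
  then obtain i j where ij: "i < j" "j \<le> p" "conjugate i = conjugate j"
    by (auto simp: inj_on_def less_Suc_eq_le) (metis nat_neq_iff)
  have "conjugate (j - i) x = x" for x
  proof -
    have "conjugate i (conjugate (j - i) x) = conjugate i x"
      using conjugate_add[of i "j - i" x] ij by simp
    then show ?thesis by simp
  qed
  then have ex: "\<exists>m. 0 < m \<and> m \<le> p \<and> conjugate m = id" using ij by (intro exI[of _ "j - i"]) auto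
  define m where "m = (LEAST m. 0 < m \<and> conjugate m = id)"
  have m: "0 < m" "conjugate m = id" and least: "\<And>n. 0 < n \<Longrightarrow> conjugate n = id \<Longrightarrow> m \<le> n"
  proof -
    let ?P = "\<lambda>m. 0 < m \<and> conjugate m = id"
    have "\<exists>m. ?P m" using ex by blast
    then have "?P m" unfolding m_def by (rule LeastI_ex)
    then show "0 < m" "conjugate m = id" by simp_all
    show "m \<le> n" if "0 < n" "conjugate n = id" for n
      unfolding m_def by (rule Least_le) (use that in simp)
  qed
  obtain n where "0 < n" "n \<le> p" "conjugate n = id" using ex by blast
  with least[of n] have "m \<le> p" by simp
  have inj: "inj_on conjugate {..<m}"
  proof (rule linorder_inj_onI)
    fix i j assume ij: "i < j" "i \<in> {..<m}" "j \<in> {..<m}"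
    show "conjugate i \<noteq> conjugate j"
    proof
      assume eq: "conjugate i = conjugate j"
      have "conjugate (j - i) = id"
      proof
        fix x
        have "conjugate i (conjugate (j - i) x) = conjugate i x"
          using conjugate_add[of i "j - i" x] ij eq by simp
        then show "conjugate (j - i) x = id x" by simp
      qed
      with least[of "j - i"] ij show False by auto
    qed
  qed auto
  have "m = p"
  proof (rule ccontr)
    assume "m \<noteq> p"
    then have "m < p" using \<open>m \<le> p\<close> by simp
    then obtain w where w: "\<exists>i\<in>{..<p}. w i \<noteq> 0"
      "\<forall>j\<in>{..<m}. (\<Sum>i\<in>{..<p}. conjugate j (B ! i) * w i) = 0"
      using homogeneous_system_solution[of "{..<m}" "{..<p}" "\<lambda>j i. conjugate j (B ! i)"] by auto
    have "\<forall>i<p. w i = 0"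
      by (rule conjugates_kernel_trivial[OF m inj B]) (use w(2) in auto)
    with w(1) show False by auto
  qed
  with m inj show "conjugate p = id" "inj_on conjugate {..<p}" by simp_all
qed

text \<open>
  Let \<open>A\<close> be the matrix of multiplication by \<open>x\<close> in the basis \<open>B\<close> and let \<open>M\<close> be the matrix of the
  conjugates of \<open>B\<close>. Applying the powers of \<open>\<sigma>\<close> to \<open>x * B ! i = \<Sum>k. A k i * B ! k\<close> shows that \<open>M\<close>
  conjugates \<open>A\<close> into the diagonal matrix of the conjugates of \<open>x\<close>; the trace is preserved.
\<close>
lemma field_trace_eq: "field_trace K x = (\<Sum>j<p. conjugate j x)"
proof -
  define B where "B = (SOME B. is_basis K B)"
  have B: "is_basis K B" unfolding B_def by (rule someI_ex[OF basis_exists])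
  define a where "a k i = coords K B (x * B ! i) ! k" for k i
  have a_K: "a k i \<in> K" if "k < p" for k i
    using is_basisE(2)[OF B, of "x * B ! i"] that by (auto simp: a_def)
  have a: "(\<Sum>k<p. a k i * B ! k) = x * B ! i" for i
    using is_basisE(2)[OF B, of "x * B ! i"] by (auto simp: a_def)
  have conjugate_x: "conjugate j (x * B ! i) = (\<Sum>k<p. a k i * conjugate j (B ! k))" for i j
    unfolding a[of i, symmetric] by (simp add: conjugate_sum conjugate_mult conjugate_K a_K)
  obtain N where
    MN: "\<And>j k. j < p \<Longrightarrow> k < p \<Longrightarrow> (\<Sum>i<p. conjugate j (B ! i) * N i k) = (if j = k then 1 else 0)" and
    NM: "\<And>i l. i < p \<Longrightarrow> l < p \<Longrightarrow> (\<Sum>j<p. N i j * conjugate j (B ! l)) = (if i = l then 1 else 0)"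
    using inverse_matrix_of_trivial_kernel[of p "\<lambda>j i. conjugate j (B ! i)"]
      conjugates_kernel_trivial[OF p_pos order_p conjugate_inj B] by blast
  have "(\<Sum>j<p. conjugate j x) = (\<Sum>j<p. conjugate j x * (\<Sum>i<p. conjugate j (B ! i) * N i j))"
    by (simp add: MN)
  also have "\<dots> = (\<Sum>j<p. \<Sum>i<p. N i j * conjugate j (x * B ! i))"
    by (simp add: sum_distrib_left conjugate_mult mult_ac)
  also have "\<dots> = (\<Sum>j<p. \<Sum>i<p. \<Sum>k<p. a k i * (N i j * conjugate j (B ! k)))"
    unfolding conjugate_x by (simp add: sum_distrib_left mult_ac)
  also have "\<dots> = (\<Sum>i<p. \<Sum>j<p. \<Sum>k<p. a k i * (N i j * conjugate j (B ! k)))"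
    by (rule sum.swap)
  also have "\<dots> = (\<Sum>i<p. \<Sum>k<p. a k i * (\<Sum>j<p. N i j * conjugate j (B ! k)))"
    unfolding sum_distrib_left by (rule sum.cong[OF refl]) (rule sum.swap)
  also have "\<dots> = (\<Sum>i<p. a i i)"
    by (simp add: NM if_distrib[of "times _"] cong: if_cong)
  also have "\<dots> = field_trace K x"
    by (simp add: field_trace_def Let_def B_def[symmetric] is_basisE(1)[OF B] a_def)
  finally show ?thesis ..
qed

end

section \<open>Convex subgroups of ordered abelian groups\<close>

text \<open>
  A value group has no numerals, so multiples of its elements are constant sums.
\<close>
abbreviation nmult :: "nat \<Rightarrow> 'g::comm_monoid_add \<Rightarrow> 'g" where
  "nmult n s \<equiv> (\<Sum>i<n. s)"

lemma nmult_mono: "s \<le> t \<Longrightarrow> nmult n s \<le> nmult n (t :: 'g::linordered_ab_group_add)"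
  by (rule sum_mono)

lemma nmult_nonneg: "0 \<le> s \<Longrightarrow> 0 \<le> nmult n (s :: 'g::linordered_ab_group_add)"
  by (rule sum_nonneg)

lemma nmult_ge: "0 \<le> s \<Longrightarrow> 0 < n \<Longrightarrow> s \<le> nmult n (s :: 'g::linordered_ab_group_add)"
  by (cases n) (simp_all add: nmult_nonneg)

lemma nmult_strict_mono:
  "s < t \<Longrightarrow> 0 < n \<Longrightarrow> nmult n s < nmult n (t :: 'g::linordered_ab_group_add)"
  by (rule sum_strict_mono) auto

lemma nmult_add: "nmult n (s + t) = nmult n s + nmult n (t :: 'g::linordered_ab_group_add)"
  by (rule sum.distrib)

locale ordered_subgroup =
  fixes \<Gamma> :: "'g::linordered_ab_group_add set"
  assumes zero_mem: "0 \<in> \<Gamma>" and add_mem: "a \<in> \<Gamma> \<Longrightarrow> b \<in> \<Gamma> \<Longrightarrow> a + b \<in> \<Gamma>"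
    and uminus_mem: "a \<in> \<Gamma> \<Longrightarrow> - a \<in> \<Gamma>"
begin

lemma diff_mem: "a \<in> \<Gamma> \<Longrightarrow> b \<in> \<Gamma> \<Longrightarrow> a - b \<in> \<Gamma>"
  using add_mem[OF _ uminus_mem, of a b] by simp

lemma convexD:
  assumes "convex_subgroup \<Gamma> H"
  shows "H \<subseteq> \<Gamma>" "0 \<in> H" "\<And>a b. a \<in> H \<Longrightarrow> b \<in> H \<Longrightarrow> a + b \<in> H" "\<And>a. a \<in> H \<Longrightarrow> - a \<in> H"
    "\<And>a b. a \<in> H \<Longrightarrow> b \<in> H \<Longrightarrow> a - b \<in> H"
    "\<And>a b c. a \<in> H \<Longrightarrow> b \<in> H \<Longrightarrow> c \<in> \<Gamma> \<Longrightarrow> a \<le> c \<Longrightarrow> c \<le> b \<Longrightarrow> c \<in> H"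
proof -
  note conv = assms[unfolded convex_subgroup_def]
  show c1: "H \<subseteq> \<Gamma>" by (rule conjunct1[OF conv])
  note conv = conjunct2[OF conv]
  show c2: "0 \<in> H" by (rule conjunct1[OF conv])
  note conv = conjunct2[OF conv]
  show c3: "a + b \<in> H" if "a \<in> H" "b \<in> H" for a b
    using conjunct1[OF conv] that by blast
  note conv = conjunct2[OF conv]
  show c4: "- a \<in> H" if "a \<in> H" for a
    using conjunct1[OF conv] that by blast
  show "c \<in> H" if "a \<in> H" "b \<in> H" "c \<in> \<Gamma>" "a \<le> c" "c \<le> b" for a b c
    using conjunct2[OF conv] that by blast
  show "a - b \<in> H" if "a \<in> H" "b \<in> H" for a b
    using c3[OF that(1) c4[OF that(2)]] by simp
qed

lemma convex_nmult: "convex_subgroup \<Gamma> H \<Longrightarrow> h \<in> H \<Longrightarrow> nmult n h \<in> H"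
  by (induction n) (simp_all add: convexD(2,3))

text \<open>
  Strong convexity in terms of elements instead of cosets: each element above \<open>H\<close> splits into two
  summands above \<open>H\<close>.
\<close>
lemma strongly_convex_iff:
  "strongly_convex \<Gamma> H \<longleftrightarrow> convex_subgroup \<Gamma> H \<and> H \<noteq> \<Gamma> \<and>
     (\<forall>\<alpha>\<in>\<Gamma>. (\<forall>h\<in>H. h < \<alpha>) \<longrightarrow> (\<exists>\<beta>\<in>\<Gamma>. (\<forall>h\<in>H. h < \<beta>) \<and> (\<forall>h\<in>H. h < \<alpha> - \<beta>)))"
proof (cases "convex_subgroup \<Gamma> H")
  case True
  note H = convexD[OF True]
  let ?C = "\<lambda>a. (+) a ` H"
  have le_iff: "coset_le (?C a) (?C b) \<longleftrightarrow> (\<exists>h\<in>H. a - b \<le> h)" for a b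
  proof
    assume "coset_le (?C a) (?C b)"
    then obtain h k where "h \<in> H" "k \<in> H" "a + h \<le> b + k" by (auto simp: coset_le_def)
    then show "\<exists>h\<in>H. a - b \<le> h" using H(5)[of k h] by (intro bexI[of _ "k - h"]) (auto simp: algebra_simps)
  next
    assume "\<exists>h\<in>H. a - b \<le> h"
    then obtain h where "h \<in> H" "a + 0 \<le> b + h" by (auto simp: algebra_simps)
    with H(2) show "coset_le (?C a) (?C b)" unfolding coset_le_def by blast
  qed
  have H_eq: "?C 0 = H" by simp
  have pos_iff: "coset_le H (?C a) \<and> ?C a \<noteq> H \<longleftrightarrow> (\<forall>h\<in>H. h < a)" if a: "a \<in> \<Gamma>" for a
  proof
    assume l: "coset_le H (?C a) \<and> ?C a \<noteq> H"
    obtain h where h: "h \<in> H" "- a \<le> h" using l le_iff[of 0 a] by auto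
    have "a \<notin> H"
    proof
      assume "a \<in> H"
      have "x \<in> ?C a" if "x \<in> H" for x
        using H(5)[OF that \<open>a \<in> H\<close>] by (intro image_eqI[of _ _ "x - a"]) auto
      then have "?C a = H" using H(3)[OF \<open>a \<in> H\<close>] by auto
      with l show False by simp
    qed
    show "\<forall>h\<in>H. h < a"
    proof (rule ccontr)
      assume "\<not> ?thesis"
      then obtain k where "k \<in> H" "a \<le> k" by (auto simp: not_less)
      then have "a \<in> H" using H(6)[of "- h" k a] H(4)[OF h(1)] h(2) a by (simp add: minus_le_iff)
      with \<open>a \<notin> H\<close> show False by simp
    qed
  next
    assume gt: "\<forall>h\<in>H. h < a"
    then have "0 < a" using H(2) by blast
    then have "\<exists>h\<in>H. 0 - a \<le> h" using H(2) by (intro bexI[of _ 0]) auto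
    then have "coset_le H (?C a)" using le_iff[of 0 a] by simp
    moreover have "a \<in> ?C a" using H(2) by force
    ultimately show "coset_le H (?C a) \<and> ?C a \<noteq> H" using gt by auto
  qed
  have "positive_cosets \<Gamma> H = ?C ` {a \<in> \<Gamma>. coset_le H (?C a) \<and> ?C a \<noteq> H}"
    unfolding positive_cosets_def group_quotient_def by blast
  also have "{a \<in> \<Gamma>. coset_le H (?C a) \<and> ?C a \<noteq> H} = {a \<in> \<Gamma>. \<forall>h\<in>H. h < a}"
    using pos_iff by (intro Collect_cong conj_cong refl)
  finally have pos: "positive_cosets \<Gamma> H = ?C ` {a \<in> \<Gamma>. \<forall>h\<in>H. h < a}" .
  show ?thesis
    unfolding strongly_convex_def pos using True
    by (auto simp: le_iff not_le Bex_def Ball_def)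
qed (simp add: strongly_convex_def)

text \<open>
  If \<open>s\<close> works for \<open>n\<close>, the smaller of two summands of \<open>s\<close> works for \<open>2 n\<close> and hence for \<open>n + 1\<close>.
\<close>
lemma strongly_convex_nmult_below:
  assumes H: "strongly_convex \<Gamma> H" and "n > 0" and "\<alpha> \<in> \<Gamma>" "\<forall>h\<in>H. h < \<alpha>"
  shows "\<exists>s\<in>\<Gamma>. (\<forall>h\<in>H. h < s) \<and> nmult n s \<le> \<alpha>"
  using assms(2)
proof (induction n rule: nat_induct_non_zero)
  case 1
  then show ?case using assms by auto
next
  case (Suc n)
  then obtain s where s: "s \<in> \<Gamma>" "\<forall>h\<in>H. h < s" "nmult n s \<le> \<alpha>" by blast
  then obtain b where b: "b \<in> \<Gamma>" "\<forall>h\<in>H. h < b" "\<forall>h\<in>H. h < s - b"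
    using H unfolding strongly_convex_iff by blast
  define t where "t = min b (s - b)"
  have "0 \<in> H" using H convexD(2) unfolding strongly_convex_def by blast
  with b have "0 < t" by (auto simp: t_def)
  have t: "t \<in> \<Gamma>" "\<forall>h\<in>H. h < t" using b s diff_mem by (auto simp: t_def min_def)
  have "nmult (Suc n) t \<le> nmult n t + nmult n t"
    using nmult_ge[of t n] \<open>0 < t\<close> Suc.hyps by simp
  also have "\<dots> = nmult n (t + t)" by (simp add: nmult_add)
  also have "\<dots> \<le> nmult n s"
  proof (rule nmult_mono)
    have "t + t \<le> b + (s - b)" by (rule add_mono) (simp_all add: t_def)
    then show "t + t \<le> s" by simp
  qed
  also have "\<dots> \<le> \<alpha>" by (rule s)
  finally show ?case using t by blast
qed

text \<open>
  A positive \<open>k \<in> H\<close> would have all its multiples below \<open>\<alpha>\<close>, against the archimedean property of the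
  reals.
\<close>
lemma archimedean_convex_trivial:
  assumes arch: "archimedean_group \<Delta>" and H: "convex_subgroup \<Gamma> H" "H \<subseteq> \<Delta>"
    and \<alpha>: "\<alpha> \<in> \<Delta>" "\<forall>h\<in>H. h < \<alpha>"
  shows "H = {0}"
proof (rule ccontr)
  assume "H \<noteq> {0}"
  then obtain h where "h \<in> H" "h \<noteq> 0" using convexD(2)[OF H(1)] by blast
  then have "0 < h \<or> 0 < - h" "- h \<in> H" using convexD(4)[OF H(1)] by auto
  with \<open>h \<in> H\<close> obtain k where k: "k \<in> H" "0 < k" by blast
  obtain f :: "'g \<Rightarrow> real" where
    f: "\<forall>a\<in>\<Delta>. \<forall>b\<in>\<Delta>. f (a + b) = f a + f b" "strict_mono_on \<Delta> f"
    using arch by (auto simp: archimedean_group_def)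
  have kn: "nmult n k \<in> H" for n by (rule convex_nmult[OF H(1) k(1)])
  have "0 \<in> \<Delta>" using convexD(2)[OF H(1)] H(2) by blast
  then have "f 0 = f 0 + f 0" using f(1) by (metis add.right_neutral)
  then have f0: "f 0 = 0" by simp
  have "f (nmult n k) = real n * f k" for n
  proof (induction n)
    case (Suc n)
    have "nmult n k \<in> \<Delta>" "k \<in> \<Delta>" using kn k H(2) by auto
    then have "f (nmult n k + k) = f (nmult n k) + f k" using f(1) by blast
    then show ?case using Suc by (simp add: algebra_simps)
  qed (simp add: f0)
  moreover have "f (nmult n k) < f \<alpha>" for n
    using f(2) kn[of n] H(2) \<alpha> by (auto simp: strict_mono_on_def)
  ultimately have bound: "real n * f k < f \<alpha>" for n by metis
  have "k \<in> \<Delta>" using k(1) H(2) by blast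
  then have "0 < f k" using strict_mono_onD[OF f(2) \<open>0 \<in> \<Delta>\<close> _ k(2)] f0 by simp
  then obtain n where "f \<alpha> < real n * f k" using reals_Archimedean3 by blast
  with bound[of n] show False by simp
qed

lemma proper_convex_bounded:
  assumes H: "convex_subgroup \<Gamma> H" "H \<noteq> \<Gamma>"
  shows "\<exists>\<alpha>\<in>\<Gamma>. \<forall>h\<in>H. h < \<alpha>"
proof -
  obtain a where a: "a \<in> \<Gamma>" "a \<notin> H" using H convexD(1) by blast
  have "\<forall>h\<in>H. h < max a (- a)"
  proof (rule ccontr)
    assume "\<not> ?thesis"
    then obtain h where h: "h \<in> H" "max a (- a) \<le> h" by (auto simp: not_less)
    then have "- h \<le> a" "a \<le> h" by (simp_all add: minus_le_iff)
    then have "a \<in> H" using convexD(4,6)[OF H(1)] h a by blast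
    with a show False by simp
  qed
  moreover have "max a (- a) \<in> \<Gamma>" using a(1) uminus_mem[OF a(1)] by (simp add: max_def)
  ultimately show ?thesis by blast
qed

end

section \<open>Valuations, coarsenings and residue fields\<close>

locale valued_field =
  fixes v :: "'a::field \<Rightarrow> 'g::linordered_ab_group_add"
  assumes valuation: "valuation v"
begin

text \<open>
  The inequality \<open>g \<le> v x\<close> under the convention \<open>v 0 = \<infinity>\<close>; it saves the case distinctions at \<open>0\<close> in
  estimates of sums and products.
\<close>
definition vge :: "'a \<Rightarrow> 'g \<Rightarrow> bool" where "vge x g \<longleftrightarrow> x = 0 \<or> g \<le> v x"

lemma v_mult: "x \<noteq> 0 \<Longrightarrow> y \<noteq> 0 \<Longrightarrow> v (x * y) = v x + v y"
  using valuation by (auto simp: valuation_def)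

lemma v_1: "v 1 = 0"
  using v_mult[of 1 1] by simp

lemma v_inverse: "x \<noteq> 0 \<Longrightarrow> v (inverse x) = - v x"
  using v_mult[of x "inverse x"] by (simp add: v_1 eq_neg_iff_add_eq_0 add.commute)

lemma v_divide: "x \<noteq> 0 \<Longrightarrow> y \<noteq> 0 \<Longrightarrow> v (x / y) = v x - v y"
  by (simp add: divide_inverse v_mult v_inverse)

lemma v_minus_1: "v (- 1) = 0"
proof -
  have "v (- 1) + v (- 1) = 0" using v_mult[of "- 1" "- 1"] by (simp add: v_1)
  then show ?thesis by simp
qed

lemma v_uminus: "x \<noteq> 0 \<Longrightarrow> v (- x) = v x"
  using v_mult[of "- 1" x] by (simp add: v_minus_1)

lemma vge_add: "vge x g \<Longrightarrow> vge y g \<Longrightarrow> vge (x + y) g"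
  using valuation unfolding valuation_def vge_def
  by (metis add.left_neutral add.right_neutral min.boundedI order_trans)

lemma vge_uminus: "vge x g \<Longrightarrow> vge (- x) g"
  by (cases "x = 0") (auto simp: vge_def v_uminus)

lemma vge_diff: "vge x g \<Longrightarrow> vge y g \<Longrightarrow> vge (x - y) g"
  using vge_add[of x g "- y"] vge_uminus by simp

lemma vge_0 [simp]: "vge 0 g" by (simp add: vge_def)

lemma vge_1 [simp]: "vge 1 0" by (simp add: vge_def v_1)

lemma vge_sum: "(\<And>a. a \<in> A \<Longrightarrow> vge (f a) g) \<Longrightarrow> vge (sum f A) g"
  by (induction A rule: infinite_finite_induct) (auto intro: vge_add)

lemma vge_mult: "vge x g \<Longrightarrow> vge y h \<Longrightarrow> vge (x * y) (g + h)"
  by (cases "x = 0"; cases "y = 0") (auto simp: vge_def v_mult intro: add_mono)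

lemma vge_trans: "vge x g \<Longrightarrow> h \<le> g \<Longrightarrow> vge x h"
  by (auto simp: vge_def)

lemma vge_of_int: "vge (of_int n) 0"
proof -
  have "vge (of_nat m) 0" for m
    by (induction m) (auto intro: vge_add)
  then show ?thesis by (cases n rule: int_cases2) (auto intro: vge_uminus)
qed

lemma v_prod_const:
  assumes "finite A" "\<And>a. a \<in> A \<Longrightarrow> f a \<noteq> 0 \<and> v (f a) = s"
  shows "prod f A \<noteq> 0 \<and> v (prod f A) = nmult (card A) s"
  using assms
  by (induction A rule: finite_induct) (auto simp: v_1 v_mult add.commute)

lemma v_power: "x \<noteq> 0 \<Longrightarrow> v (x ^ n) = nmult n (v x)"
  by (induction n) (auto simp: v_1 v_mult add.commute)

lemma v_add_eq:
  assumes "x \<noteq> 0" "y \<noteq> 0" "v x < v y"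
  shows "x + y \<noteq> 0 \<and> v (x + y) = v x"
proof -
  have ne: "x + y \<noteq> 0"
    using assms v_uminus[of x] by (metis add_eq_0_iff less_irrefl)
  have "v x \<le> v (x + y)" using vge_add[of x "v x" y] assms ne by (auto simp: vge_def)
  moreover have "v (x + y) \<le> v x"
  proof (rule ccontr)
    assume "\<not> ?thesis"
    then obtain g where g: "v x < g" "g \<le> v (x + y)" "g \<le> v y"
      using assms(3) by (metis linorder_le_cases not_le order_refl)
    then have "vge ((x + y) - y) g" by (intro vge_diff) (auto simp: vge_def)
    with assms(1) g show False by (auto simp: vge_def)
  qed
  ultimately show ?thesis using ne by simp
qed

lemma value_group_closed:
  "0 \<in> value_group v UNIV"
  "a \<in> value_group v UNIV \<Longrightarrow> b \<in> value_group v UNIV \<Longrightarrow> a + b \<in> value_group v UNIV"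
  "a \<in> value_group v UNIV \<Longrightarrow> - a \<in> value_group v UNIV"
proof -
  show "0 \<in> value_group v UNIV" unfolding value_group_def
    by (rule image_eqI[of _ _ 1]) (auto simp: v_1)
  show "- a \<in> value_group v UNIV" if a: "a \<in> value_group v UNIV"
  proof -
    obtain x where "x \<noteq> 0" "a = v x" using a by (auto simp: value_group_def)
    then show ?thesis unfolding value_group_def
      by (intro image_eqI[of _ _ "inverse x"]) (auto simp: v_inverse)
  qed
  show "a + b \<in> value_group v UNIV" if ab: "a \<in> value_group v UNIV" "b \<in> value_group v UNIV"
  proof -
    obtain x y where "x \<noteq> 0" "a = v x" "y \<noteq> 0" "b = v y" using ab by (auto simp: value_group_def)
    then show ?thesis unfolding value_group_def
      by (intro image_eqI[of _ _ "x * y"]) (auto simp: v_mult)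
  qed
qed

end

sublocale valued_field \<subseteq> ordered_subgroup "value_group v UNIV"
  by unfold_locales (rule value_group_closed; assumption)+

context valued_field begin

text \<open>
  The valuation itself is its coarsening at the trivial subgroup, so that facts on coarsenings cover
  both cases.
\<close>
lemma coarse_ring_zero: "coarse_ring v {0} F = val_ring v F"
  and coarse_max_ideal_zero: "coarse_max_ideal v {0} F = max_ideal v F"
  by (auto simp: coarse_ring_def val_ring_def coarse_max_ideal_def max_ideal_def)

lemma convex_subgroup_zero: "convex_subgroup (value_group v UNIV) {0}"
  using value_group_closed(1) by (auto simp: convex_subgroup_def)

lemma v_add_ge: "x + y = 0 \<or> x = 0 \<or> y = 0 \<or> min (v x) (v y) \<le> v (x + y)"
  using valuation unfolding valuation_def by blast

lemma subring_coarse_ring: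
  assumes F: "subfield F ring_of_type_algebra" and H: "convex_subgroup (value_group v UNIV) H"
  shows "subring (coarse_ring v H F) ring_of_type_algebra"
proof -
  note F = subfield_record_closed[OF F] and H = convexD[OF H]
  have mem: "x \<in> coarse_ring v H F \<longleftrightarrow> x \<in> F \<and> (\<exists>h\<in>H. vge x h)" for x
    using H(2) by (auto simp: coarse_ring_def vge_def)
  show ?thesis
  proof (rule subring_recordI)
    show "1 \<in> coarse_ring v H F" unfolding mem using F(2) H(2) vge_1 by blast
    show "- x \<in> coarse_ring v H F" if "x \<in> coarse_ring v H F" for x
      using that F(5) vge_uminus unfolding mem by blast
    show "x * y \<in> coarse_ring v H F" if "x \<in> coarse_ring v H F" "y \<in> coarse_ring v H F" for x y
      using that F(4) H(3) vge_mult unfolding mem by blast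
    show "x + y \<in> coarse_ring v H F" if xy: "x \<in> coarse_ring v H F" "y \<in> coarse_ring v H F" for x y
    proof -
      obtain h k where hk: "x \<in> F" "y \<in> F" "h \<in> H" "k \<in> H" "vge x h" "vge y k"
        using xy unfolding mem by blast
      then have "vge (x + y) (min h k)" by (intro vge_add) (auto intro: vge_trans)
      moreover have "min h k \<in> H" using hk by (simp add: min_def)
      ultimately show ?thesis unfolding mem using F(3) hk by blast
    qed
  qed
qed

lemma ideal_coarse_max_ideal:
  assumes F: "subfield F ring_of_type_algebra" and H: "convex_subgroup (value_group v UNIV) H"
  shows "ideal (coarse_max_ideal v H F) (ring_on (coarse_ring v H F))"
proof (rule ideal_ring_onI[OF subring_coarse_ring[OF assms]])
  note F = subfield_record_closed[OF F] and H = convexD[OF H]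
  show "coarse_max_ideal v H F \<subseteq> coarse_ring v H F"
    using H(2) by (force simp: coarse_max_ideal_def coarse_ring_def)
  show "0 \<in> coarse_max_ideal v H F" using F(1) by (simp add: coarse_max_ideal_def)
  show "x + y \<in> coarse_max_ideal v H F"
    if "x \<in> coarse_max_ideal v H F" "y \<in> coarse_max_ideal v H F" for x y
    using that v_add_ge[of x y] F(3) by (force simp: coarse_max_ideal_def min_def split: if_splits)
  show "x * y \<in> coarse_max_ideal v H F"
    if x: "x \<in> coarse_ring v H F" and y: "y \<in> coarse_max_ideal v H F" for x y
  proof (cases "x = 0 \<or> y = 0")
    case True
    then show ?thesis using F(1) by (auto simp: coarse_max_ideal_def)
  next
    case False
    obtain k where k: "k \<in> H" "k \<le> v x" "x \<in> F" using x False by (auto simp: coarse_ring_def)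
    have "h < v (x * y)" if "h \<in> H" for h
    proof -
      have "h - k \<in> H" by (rule H(5)[OF that k(1)])
      then have "h - k < v y" using y False by (auto simp: coarse_max_ideal_def)
      then have "k + (h - k) < v x + v y" using k(2) by (rule add_le_less_mono[rotated])
      then show ?thesis using False by (simp add: v_mult)
    qed
    then show ?thesis using F(4) k y by (auto simp: coarse_max_ideal_def)
  qed
qed

lemmas subring_val_ring = subring_coarse_ring[OF _ convex_subgroup_zero, unfolded coarse_ring_zero]
lemmas ideal_max_ideal =
  ideal_coarse_max_ideal[OF _ convex_subgroup_zero, unfolded coarse_ring_zero coarse_max_ideal_zero]

lemma ring_char_residue_field:
  assumes "subfield F ring_of_type_algebra"
  shows "ring_char (residue_field v F) = Gcd {n. of_nat n \<in> max_ideal v F}"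
  unfolding residue_field_def
  by (rule ring_char_quotient[OF subring_val_ring[OF assms] ideal_max_ideal[OF assms]])

text \<open>
  An integral element outside the maximal ideal is a unit.
\<close>
lemma residue_field_is_field: "Ring.field (residue_field v UNIV)"
proof -
  let ?O = "val_ring v UNIV" and ?M = "max_ideal v UNIV"
  have U: "subfield UNIV (ring_of_type_algebra :: 'a ring)" by (rule subfield_recordI) auto
  have "maximalideal ?M (ring_on ?O)"
  proof (rule maximalidealI)
    show "ideal ?M (ring_on ?O)" by (rule ideal_max_ideal[OF U])
    have "1 \<in> ?O" "1 \<notin> ?M" by (auto simp: val_ring_def max_ideal_def v_1)
    then show "carrier (ring_on ?O) \<noteq> ?M" by auto
    fix J assume J: "ideal J (ring_on ?O)" "?M \<subseteq> J" "J \<subseteq> carrier (ring_on ?O)"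
    show "J = ?M \<or> J = carrier (ring_on ?O)"
    proof (rule disjCI)
      assume "J \<noteq> carrier (ring_on ?O)"
      moreover have "J = ?O" if x: "x \<in> J" "x \<notin> ?M" for x
      proof -
        have "x \<noteq> 0" "v x = 0" using x J(3) by (auto simp: max_ideal_def val_ring_def)
        then have "inverse x \<in> ?O" by (auto simp: val_ring_def v_inverse)
        then have "inverse x * x \<in> J" using ideal_ring_onD(4)[OF J(1)] x by blast
        then have "1 \<in> J" using \<open>x \<noteq> 0\<close> by simp
        then show ?thesis using ideal_ring_onD(4)[OF J(1), of _ 1] J(3) by auto
      qed
      ultimately show "J = ?M" using J(2) by auto
    qed
  qed
  then show ?thesis unfolding residue_field_def
    by (rule maximalideal.quotient_is_field) (rule cring_ring_on[OF subring_val_ring[OF U]])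
qed

text \<open>
  The residue field of \<open>L\<close> is one-dimensional over the image of that of \<open>K\<close> and contains \<open>1\<close>, so the
  two agree.
\<close>
lemma inertia_degree_one:
  assumes K: "subfield K ring_of_type_algebra" and "inertia_degree K v = 1"
    and x: "x \<noteq> 0" "v x = 0"
  shows "\<exists>c\<in>K. x = c \<or> 0 < v (x - c)"
proof -
  let ?O = "val_ring v UNIV" and ?M = "max_ideal v UNIV"
  let ?R = "ring_on ?O" and ?Q = "residue_field v UNIV"
  let ?res = "\<lambda>x. ?M +>\<^bsub>?R\<^esub> x"
  have U: "subfield UNIV (ring_of_type_algebra :: 'a ring)" by (rule subfield_recordI) auto
  note OS = subring_val_ring[OF U] and KS = subring_val_ring[OF K]
  interpret R: cring ?R by (rule cring_ring_on[OF OS])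
  interpret M: ideal ?M ?R by (rule ideal_max_ideal[OF U])
  interpret h: ring_hom_ring ?R ?Q ?res
    unfolding residue_field_def by (rule M.rcos_ring_hom_ring)
  interpret Q: Ring.field ?Q by (rule residue_field_is_field)
  have OK: "val_ring v K \<subseteq> ?O" by (auto simp: val_ring_def)
  have "subring (val_ring v K) ?R"
    by (rule R.subringI)
      (use OK subring_record_closed[OF KS] a_minus_ring_on[OF OS] in \<open>auto simp: subset_iff\<close>)
  then have "subring (?res ` val_ring v K) ?Q" by (rule h.img_is_subring)
  then have sub: "subfield (?res ` val_ring v K) ?Q"
  proof (rule Q.subfieldI')
    fix k assume k: "k \<in> ?res ` val_ring v K - {\<zero>\<^bsub>?Q\<^esub>}"
    then obtain c where c: "c \<in> val_ring v K" "k = ?res c" by blast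
    have "k \<noteq> ?res 0" using k h.hom_zero by simp
    then have "c \<notin> ?M"
      using c coset_eq_iff[OF OS M.is_ideal, of c 0] OK subring_record_closed(1)[OF OS] by auto
    then have c0: "c \<noteq> 0" "v c = 0" using c(1) by (auto simp: max_ideal_def val_ring_def)
    then have ic: "inverse c \<in> val_ring v K"
      using c(1) subfield_record_closed(6)[OF K] by (auto simp: val_ring_def v_inverse)
    have "?res c \<otimes>\<^bsub>?Q\<^esub> ?res (inverse c) = ?res 1"
      using h.hom_mult[of c "inverse c"] c ic OK c0 by auto
    also have "\<dots> = \<one>\<^bsub>?Q\<^esub>" using h.hom_one by simp
    finally have "inv\<^bsub>?Q\<^esub> k = ?res (inverse c)"
      using c ic OK by (intro Q.comm_inv_char) auto
    then show "inv\<^bsub>?Q\<^esub> k \<in> ?res ` val_ring v K" using ic by blast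
  qed
  have "ring.dimension ?Q 1 (?res ` val_ring v K) (carrier ?Q)"
    using dimension_of_ext_degree[OF h.S.ring_axioms sub] assms(2) by (simp add: inertia_degree_def)
  then have "carrier ?Q = ?res ` val_ring v K"
    by (rule ring.dimension_one_eq[OF h.S.ring_axioms sub]) auto
  moreover have xO: "x \<in> ?O" using x by (simp add: val_ring_def)
  ultimately obtain c where c: "c \<in> val_ring v K" "?res x = ?res c"
    using h.hom_closed[of x] by auto
  then have "x - c \<in> ?M" using coset_eq_iff[OF OS M.is_ideal xO, of c] OK by auto
  then show ?thesis using c by (auto simp: max_ideal_def val_ring_def)
qed

lemma ramification_index_one:
  assumes K: "subfield K ring_of_type_algebra" and "ramification_index K v = 1" and "x \<noteq> 0"
  shows "\<exists>c\<in>K. c \<noteq> 0 \<and> v c = v x"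
proof -
  let ?\<Gamma> = "value_group v K"
  have 0: "0 \<in> ?\<Gamma>" using subfield_record_closed(2)[OF K]
    by (auto simp: value_group_def v_1 intro!: image_eqI[where x = 1])
  obtain C where C: "group_quotient (value_group v UNIV) ?\<Gamma> = {C}"
    using card_1_singletonE[OF assms(2)[unfolded ramification_index_def]] by metis
  have C_eq: "(+) a ` ?\<Gamma> = C" if "a \<in> value_group v UNIV" for a
  proof -
    have "(+) a ` ?\<Gamma> \<in> group_quotient (value_group v UNIV) ?\<Gamma>"
      unfolding group_quotient_def using that by (rule imageI)
    then show ?thesis unfolding C by (rule singletonD)
  qed
  have "v x \<in> value_group v UNIV" using \<open>x \<noteq> 0\<close> by (simp add: value_group_def)
  then have "(+) (v x) ` ?\<Gamma> = (+) 0 ` ?\<Gamma>" using C_eq value_group_closed(1) by metis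
  moreover have "v x \<in> (+) (v x) ` ?\<Gamma>" using 0 by (intro image_eqI[where x = 0]) auto
  ultimately have "v x \<in> (+) 0 ` ?\<Gamma>" by blast
  then show ?thesis by (auto simp: value_group_def)
qed

text \<open>
  The preimage of the valuation ring of \<open>L\<close> under \<open>\<sigma>\<close> is a valuation ring over that of \<open>K\<close>, hence the
  same ring. So \<open>\<sigma>\<close> preserves units, and every element is a unit times an element of \<open>K\<close>.
\<close>
lemma unibranched_invariant:
  assumes K: "subfield K ring_of_type_algebra" and un: "unibranched K v"
    and \<sigma>: "\<sigma> \<in> galois_group K"
    and lift: "\<And>x. x \<noteq> 0 \<Longrightarrow> \<exists>c\<in>K. c \<noteq> 0 \<and> v c = v x" and "x \<noteq> 0"
  shows "v (\<sigma> x) = v x"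
proof -
  have hom: "\<And>x y. \<sigma> (x + y) = \<sigma> x + \<sigma> y" "\<And>x y. \<sigma> (x * y) = \<sigma> x * \<sigma> y" "\<sigma> 1 = 1"
    and fix_K: "\<And>x. x \<in> K \<Longrightarrow> \<sigma> x = x" and bij: "bij \<sigma>"
    using \<sigma> by (auto simp: galois_group_def ring_iso_def ring_hom_def)
  have zero: "\<sigma> 0 = 0" using fix_K subfield_record_closed(1)[OF K] by blast
  have neg: "\<sigma> (- x) = - \<sigma> x" for x
    using hom(1)[of x "- x"] zero by (simp add: eq_neg_iff_add_eq_0 add.commute)
  have nz: "\<sigma> x \<noteq> 0" if "x \<noteq> 0" for x
    using bij zero that by (metis bij_is_inj inj_eq)
  have inv: "\<sigma> (inverse x) = inverse (\<sigma> x)" if "x \<noteq> 0" for x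
    using hom(2)[of x "inverse x"] hom(3) that by (intro inverse_unique[symmetric]) simp
  have U: "subfield UNIV (ring_of_type_algebra :: 'a ring)" by (rule subfield_recordI) auto
  let ?A = "{x. \<sigma> x \<in> val_ring v UNIV}"
  have "subring ?A ring_of_type_algebra"
    by (rule subring_recordI)
      (use subring_record_closed[OF subring_val_ring[OF U]] hom neg in auto)
  moreover have "x \<in> ?A \<or> inverse x \<in> ?A" if "x \<noteq> 0" for x
    using nz[OF that] inv[OF that] by (auto simp: val_ring_def v_inverse)
  ultimately have "valuation_subring ?A" by (simp add: valuation_subring_def)
  moreover have "?A \<inter> K = val_ring v K" using fix_K by (auto simp: val_ring_def)
  ultimately have A: "?A = val_ring v UNIV" 
    using un unfolding unibranched_def by blast
  have unit: "v (\<sigma> y) = 0" if y: "y \<noteq> 0" "v y = 0" for y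
  proof -
    have "y \<in> ?A" "inverse y \<in> ?A" unfolding A using y by (auto simp: val_ring_def v_inverse)
    then have "0 \<le> v (\<sigma> y)" "0 \<le> - v (\<sigma> y)"
      using nz[OF y(1)] by (auto simp: val_ring_def v_inverse inv[OF y(1)])
    then show ?thesis by simp
  qed
  obtain c where c: "c \<in> K" "c \<noteq> 0" "v c = v x" using lift[OF \<open>x \<noteq> 0\<close>] by blast
  have "v (\<sigma> (x * inverse c)) = 0"
    by (rule unit) (use c \<open>x \<noteq> 0\<close> in \<open>auto simp: v_mult v_inverse\<close>)
  then show ?thesis
    using c nz[OF \<open>x \<noteq> 0\<close>] by (simp add: hom inv fix_K v_mult v_inverse)
qed

end

section \<open>The trace in an immediate cyclic extension\<close>

text \<open>
  The properties of a Galois defect extension of prime degree from which the trace is computed: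
  invariance of \<open>v\<close> under \<open>\<sigma>\<close>, equality of the value groups and of the residue fields, and, outside
  characteristic \<open>p\<close>, a primitive \<open>p\<close>-th root of unity in \<open>K\<close>.
\<close>
locale immediate_cyclic_extension =
  prime_cyclic_extension K \<sigma> p + valued_field v
  for K :: "'a::field set" and \<sigma> :: "'a \<Rightarrow> 'a" and p :: nat
    and v :: "'a \<Rightarrow> 'g::linordered_ab_group_add" +
  assumes v_\<sigma>: "x \<noteq> 0 \<Longrightarrow> v (\<sigma> x) = v x"
    and value_lift: "x \<noteq> 0 \<Longrightarrow> \<exists>c\<in>K. c \<noteq> 0 \<and> v c = v x"
    and residue_lift: "x \<noteq> 0 \<Longrightarrow> v x = 0 \<Longrightarrow> \<exists>c\<in>K. x = c \<or> 0 < v (x - c)"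
    and root_of_unity: "of_nat p \<noteq> (0::'a) \<Longrightarrow> \<exists>\<zeta>\<in>K. \<zeta> ^ p = 1 \<and> \<zeta> \<noteq> 1"
begin

abbreviation S :: "'g set" where "S \<equiv> ram_Sigma v \<sigma>"

definition Tr :: "'a \<Rightarrow> 'a" where "Tr x = (\<Sum>j<p. conjugate j x)"

lemma v_conj: "x \<noteq> 0 \<Longrightarrow> v (conjugate j x) = v x"
  by (induction j) (simp_all add: conjugate_Suc v_\<sigma>)

lemma vge_conj: "vge x g \<Longrightarrow> vge (conjugate j x) g"
  by (cases "x = 0") (auto simp: vge_def v_conj)

lemma \<sigma>_simps: "\<sigma> 0 = 0" "\<sigma> (x - y) = \<sigma> x - \<sigma> y" "\<sigma> (x / y) = \<sigma> x / \<sigma> y"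
  using conjugate_zero[of "Suc 0", unfolded conjugate_1] conjugate_diff[of "Suc 0"] conjugate_divide[of "Suc 0"]
  by simp_all

lemma S_I: "b \<noteq> 0 \<Longrightarrow> \<sigma> b \<noteq> b \<Longrightarrow> v (\<sigma> b - b) - v b \<in> S"
  unfolding ram_Sigma_def by (auto simp: v_divide intro!: exI[of _ b])

text \<open>
  Dividing \<open>b\<close> by an element of \<open>K\<close> of the same value does not change \<open>v (\<delta> b / b)\<close>.
\<close>
lemma S_unitE:
  assumes "s \<in> S"
  obtains b where "b \<noteq> 0" "\<sigma> b \<noteq> b" "v b = 0" "v (\<sigma> b - b) = s"
proof -
  obtain b where b: "b \<noteq> 0" "\<sigma> b \<noteq> b" "s = v ((\<sigma> b - b) / b)"
    using assms by (auto simp: ram_Sigma_def)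
  obtain c where c: "c \<in> K" "c \<noteq> 0" "v c = v b" using value_lift b(1) by blast
  have eq: "\<sigma> (b / c) - b / c = (\<sigma> b - b) / c"
    using \<sigma>_K[OF c(1)] by (simp add: \<sigma>_simps diff_divide_distrib)
  show thesis
  proof (rule that[of "b / c"])
    show "\<sigma> (b / c) \<noteq> b / c" using eq b c by auto
    show "v (\<sigma> (b / c) - b / c) = s" unfolding eq using b c by (simp add: v_divide)
  qed (use b c in \<open>simp_all add: v_divide\<close>)
qed

lemma S_subset: "S \<subseteq> value_group v UNIV"
  by (auto simp: ram_Sigma_def value_group_def)

lemma S_nonempty: "S \<noteq> {}"
proof -
  obtain b where "\<sigma> b \<noteq> b" using nontrivial by (auto simp: fun_eq_iff)
  moreover then have "b \<noteq> 0" using \<sigma>_simps(1) by auto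
  ultimately show ?thesis using S_I by blast
qed

text \<open>
  If \<open>b\<close> is a unit and \<open>c \<in> K\<close> has the same residue, then \<open>b\<close> and \<open>b - c\<close> have the same image under
  \<open>\<sigma> - 1\<close>, but \<open>b - c\<close> has positive value. This is where \<open>Lv = Kv\<close> enters.
\<close>
lemma S_no_least:
  assumes "s \<in> S"
  shows "\<exists>s'\<in>S. s' < s"
proof -
  obtain b where b: "b \<noteq> 0" "\<sigma> b \<noteq> b" "v b = 0" "v (\<sigma> b - b) = s" using S_unitE[OF assms] .
  obtain c where c: "c \<in> K" "b = c \<or> 0 < v (b - c)" using residue_lift b by blast
  have "b \<noteq> c" using b c \<sigma>_K by auto
  have eq: "\<sigma> (b - c) - (b - c) = \<sigma> b - b" by (simp add: \<sigma>_simps \<sigma>_K c)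
  then have "\<sigma> (b - c) \<noteq> b - c" using b by auto
  then have "v (\<sigma> (b - c) - (b - c)) - v (b - c) \<in> S"
    using \<open>b \<noteq> c\<close> by (intro S_I) auto
  then show ?thesis using b c \<open>b \<noteq> c\<close> unfolding eq by (intro bexI) auto
qed

lemma S_pos:
  assumes "s \<in> S"
  shows "0 < s"
proof -
  obtain t where t: "t \<in> S" "t < s" using S_no_least assms by blast
  obtain b where b: "b \<noteq> 0" "\<sigma> b \<noteq> b" "v b = 0" "v (\<sigma> b - b) = t" using S_unitE[OF t(1)] .
  have "vge (\<sigma> b - b) 0" using b v_\<sigma> by (intro vge_diff) (auto simp: vge_def)
  with b t show ?thesis by (auto simp: vge_def)
qed

text \<open>
  For a unit \<open>b\<close> and \<open>d \<in> K\<close> of value \<open>t - s > 0\<close>, the unit \<open>1 + d * b\<close> has \<open>d * (\<sigma> b - b)\<close> as its image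
  under \<open>\<sigma> - 1\<close>.
\<close>
lemma S_upward:
  assumes "s \<in> S" "s \<le> t" "t \<in> value_group v UNIV"
  shows "t \<in> S"
proof (cases "s = t")
  case False
  obtain b where b: "b \<noteq> 0" "\<sigma> b \<noteq> b" "v b = 0" "v (\<sigma> b - b) = s" using S_unitE[OF assms(1)] .
  have "t - s \<in> value_group v UNIV"
    using assms S_subset value_group_closed(2)[of t "- s"] value_group_closed(3) by auto
  then obtain y where "y \<noteq> 0" "v y = t - s" unfolding value_group_def by force
  with value_lift[of y] obtain d where d: "d \<in> K" "d \<noteq> 0" "v d = t - s" by metis
  have u: "1 + d * b \<noteq> 0 \<and> v (1 + d * b) = v 1"
    using b d False assms(2) by (intro v_add_eq) (auto simp: v_1 v_mult)
  have eq: "\<sigma> (1 + d * b) - (1 + d * b) = d * (\<sigma> b - b)"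
    by (simp add: \<sigma>_add \<sigma>_1 \<sigma>_mult \<sigma>_K[OF d(1)] algebra_simps)
  then have "\<sigma> (1 + d * b) \<noteq> 1 + d * b" using b d by auto
  with u have "v (\<sigma> (1 + d * b) - (1 + d * b)) - v (1 + d * b) \<in> S" by (intro S_I) auto
  then show ?thesis unfolding eq using u b d by (simp add: v_mult v_1)
qed (use assms in simp)

text \<open>
  For a power \<open>\<tau>\<close> of \<open>\<sigma>\<close>, the difference \<open>\<tau>\<^sup>k b - b\<close> is a sum of conjugates of \<open>\<tau> b - b\<close>, so its value is not smaller. As \<open>\<sigma>\<close>
  and \<open>\<sigma>\<^sup>j\<close> are powers of each other, the two values agree.
\<close>
lemma v_conj_diff:
  assumes "0 < j" "j < p" "\<sigma> b \<noteq> b"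
  shows "conjugate j b \<noteq> b \<and> v (conjugate j b - b) = v (\<sigma> b - b)"
proof -
  have step: "vge (conjugate (i * k) b - b) (v (conjugate i b - b))" if "conjugate i b \<noteq> b" for i k
  proof (induction k)
    case (Suc k)
    have "conjugate (i * Suc k) b - b = conjugate (i * k) (conjugate i b - b) + (conjugate (i * k) b - b)"
      by (simp add: conjugate_diff conjugate_add[symmetric] add.commute[of i])
    moreover have "vge (conjugate (i * k) (conjugate i b - b)) (v (conjugate i b - b))"
      by (rule vge_conj) (simp add: vge_def)
    ultimately show ?case using Suc by (simp only: vge_add)
  qed simp
  have "coprime j p" using assms prime_p
    by (metis coprime_commute nat_dvd_not_less prime_imp_coprime)
  then obtain k q where q: "j * k = 1 + q * p"
    using bezout_nat[of j p] assms(1) by (metis add.commute coprime_imp_gcd_eq_1 mult.commute not_gr0)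
  have per: "conjugate (1 + q * p) b = \<sigma> b" for b
  proof -
    have "conjugate (q * p) b = b" for b
      by (induction q) (simp_all add: conjugate_add order_p)
    then show ?thesis by (simp only: conjugate_add) simp
  qed
  have ne: "conjugate j b \<noteq> b"
  proof
    assume fix_j: "conjugate j b = b"
    have "conjugate (j * k) b = b" by (induction k) (simp_all add: conjugate_add fix_j)
    with per[of b] q assms show False by simp
  qed
  have "v (conjugate j b - b) \<le> v (\<sigma> b - b)"
    using step[OF ne, of k] assms(3) per[of b] unfolding q by (simp add: vge_def)
  moreover have "v (\<sigma> b - b) \<le> v (conjugate j b - b)"
    using step[of 1 j] assms(3) ne by (simp add: vge_def)
  ultimately show ?thesis using ne by simp
qed

definition conjugates :: "'a \<Rightarrow> 'a set" where "conjugates b = (\<lambda>j. conjugate j b) ` {..<p}"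

text \<open>
  For \<open>b\<close> with minimal polynomial \<open>f\<close> over \<open>K\<close> this is \<open>b\<^bsup>p-1\<^esup> / f'(b)\<close>, the element of trace \<open>1\<close> in
  Euler's formula for the dual basis of the powers of \<open>b\<close>.
\<close>
definition trace_one :: "'a \<Rightarrow> 'a" where
  "trace_one b = b ^ (p - 1) / (\<Prod>d\<in>conjugates b - {b}. b - d)"

lemma conjugate_inj_on: 
  assumes "\<sigma> b \<noteq> b"
  shows "inj_on (\<lambda>j. conjugate j b) {..<p}"
proof (rule linorder_inj_onI)
  fix i j assume ij: "i < j" "i \<in> {..<p}" "j \<in> {..<p}"
  have "conjugate j b = conjugate i (conjugate (j - i) b)" using conjugate_add[of i "j - i" b] ij by simp
  moreover have "conjugate (j - i) b \<noteq> b" using v_conj_diff[of "j - i" b] assms ij by auto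
  ultimately show "conjugate i b \<noteq> conjugate j b" by simp
qed auto

lemma card_conjugates: "\<sigma> b \<noteq> b \<Longrightarrow> card (conjugates b) = p"
  unfolding conjugates_def by (simp add: card_image conjugate_inj_on)

lemma conjugates_image: "conjugate j ` conjugates b = conjugates b"
proof -
  have "\<sigma> ` conjugates b \<subseteq> conjugates b"
  proof
    fix x assume "x \<in> \<sigma> ` conjugates b"
    then obtain i where i: "i < p" "x = conjugate (Suc i) b" by (auto simp: conjugates_def conjugate_Suc)
    show "x \<in> conjugates b"
    proof (cases "Suc i = p")
      case True
      then show ?thesis using i order_p p_pos
        by (auto simp: conjugates_def intro!: image_eqI[of _ _ 0])
    next
      case False
      then show ?thesis using i by (auto simp: conjugates_def intro!: image_eqI[of _ _ "Suc i"])
    qed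
  qed
  then have sub: "conjugate j ` conjugates b \<subseteq> conjugates b" 
    by (induction j) (auto simp: conjugate_Suc)
  show ?thesis
    by (rule endo_inj_surj[OF _ sub]) (auto simp: conjugates_def inj_on_def)
qed

lemma conjugate_trace_one:
  "conjugate j (trace_one b) = conjugate j b ^ (p - 1) / (\<Prod>d\<in>conjugates b - {conjugate j b}. conjugate j b - d)"
proof -
  have "conjugates b - {conjugate j b} = conjugate j ` (conjugates b - {b})"
    using conjugates_image[of j b] by (auto simp: image_set_diff[OF bij_is_inj[OF bij_conj]])
  then have "(\<Prod>d\<in>conjugates b - {conjugate j b}. conjugate j b - d) = (\<Prod>d\<in>conjugates b - {b}. conjugate j b - conjugate j d)"
    by (simp add: prod.reindex inj_on_def)
  then show ?thesis by (simp add: trace_one_def conjugate_divide conjugate_power conjugate_prod conjugate_diff)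
qed

lemma Tr_trace_one:
  assumes "\<sigma> b \<noteq> b"
  shows "Tr (trace_one b) = 1"
proof -
  have "Tr (trace_one b) = (\<Sum>c\<in>conjugates b. c ^ (p - 1) / (\<Prod>d\<in>conjugates b - {c}. c - d))"
    unfolding Tr_def conjugate_trace_one
    by (subst (3) conjugates_def) (simp add: sum.reindex conjugate_inj_on[OF assms])
  also have "\<dots> = 1"
    using lagrange_top_coefficient[of "conjugates b"] card_conjugates[OF assms] p_pos
    by (auto simp: conjugates_def)
  finally show ?thesis .
qed

lemma v_trace_one:
  assumes "b \<noteq> 0" "\<sigma> b \<noteq> b"
  shows "trace_one b \<noteq> 0 \<and> v (trace_one b) = - nmult (p - 1) (v (\<sigma> b - b) - v b)"
proof -
  have b: "b \<in> conjugates b" using p_pos by (auto simp: conjugates_def intro!: image_eqI[of _ _ 0])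
  have "b - d \<noteq> 0 \<and> v (b - d) = v (\<sigma> b - b)" if d: "d \<in> conjugates b - {b}" for d
  proof -
    obtain j where j: "j < p" "d = conjugate j b" "d \<noteq> b"
      using d unfolding conjugates_def by blast
    then have "0 < j" by (cases "j = 0") auto
    with v_conj_diff[of j b] j assms show ?thesis using v_uminus[of "b - d"] by auto
  qed
  from v_prod_const[of "conjugates b - {b}", OF _ this]
  have prod: "(\<Prod>d\<in>conjugates b - {b}. b - d) \<noteq> 0 \<and>
      v (\<Prod>d\<in>conjugates b - {b}. b - d) = nmult (p - 1) (v (\<sigma> b - b))"
    using b card_conjugates[OF assms(2)] by (auto simp: conjugates_def)
  have "trace_one b \<noteq> 0" using prod assms by (simp add: trace_one_def)
  moreover have "v (trace_one b) = nmult (p - 1) (v b) - nmult (p - 1) (v (\<sigma> b - b))"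
    using prod assms by (simp add: trace_one_def v_divide v_power)
  ultimately show ?thesis by (simp only: sum_subtractf) simp
qed

lemma Tr_K: "Tr x \<in> K"
proof -
  have "\<sigma> (Tr x) = (\<Sum>j<p. conjugate (Suc j) x)"
    using conjugate_sum[of "Suc 0" "\<lambda>j. conjugate j x" "{..<p}"] by (simp add: Tr_def conjugate_Suc)
  also have "\<dots> = Tr x" unfolding Tr_def by (rule cyclic_sum) (use p_pos order_p in auto)
  finally show ?thesis by (simp add: fixed_iff)
qed

lemma Tr_scale: "c \<in> K \<Longrightarrow> Tr (c * x) = c * Tr x"
  by (simp add: Tr_def conjugate_mult conjugate_K sum_distrib_left)

text \<open>
  Let \<open>e\<close> be a nonzero Lagrange resolvent of a root of unity \<open>\<zeta>\<close>; so \<open>\<sigma> e = \<zeta> * e\<close>. Then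
  \<open>trace_one e\<close> is the inverse of the product of all \<open>1 - \<zeta>\<^sup>j\<close>, which lies in \<open>K\<close>. Its trace is
  therefore \<open>p\<close> times itself, as well as \<open>1\<close>, and its value is known.
\<close>
lemma v_p_ramification:
  assumes "of_nat p \<noteq> (0::'a)"
  shows "\<exists>s\<in>S. v (of_nat p) = nmult (p - 1) s"
proof -
  obtain \<zeta> where z: "\<zeta> \<in> K" "\<zeta> ^ p = 1" "\<zeta> \<noteq> 1" using root_of_unity[OF assms] by blast
  have z0: "\<zeta> \<noteq> 0"
  proof
    assume "\<zeta> = 0"
    with z(2) p_pos show False by (simp add: power_0_left)
  qed
  define R where "R x = (\<Sum>j<p. inverse \<zeta> ^ j * conjugate j x)" for x
  have "\<exists>x. R x \<noteq> 0"
  proof (rule ccontr)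
    assume "\<not> ?thesis"
    then have "\<forall>j\<in>{..<p}. inverse \<zeta> ^ j = 0"
      by (intro conjugate_independent conjugate_inj) (auto simp: R_def)
    with z0 p_pos show False by auto
  qed
  then obtain x where x: "R x \<noteq> 0" by blast
  have "\<sigma> (R x) = (\<Sum>j<p. inverse \<zeta> ^ j * conjugate (Suc j) x)"
    using conjugate_sum[of "Suc 0" "\<lambda>j. inverse \<zeta> ^ j * conjugate j x" "{..<p}"]
    by (simp add: R_def conjugate_Suc \<sigma>_mult \<sigma>_K[OF K_power[OF K_closed(6)[OF z(1)]]])
  also have "\<dots> = \<zeta> * (\<Sum>j<p. inverse \<zeta> ^ Suc j * conjugate (Suc j) x)"
    using z0 by (simp add: sum_distrib_left mult.assoc[symmetric])
  also have "(\<Sum>j<p. inverse \<zeta> ^ Suc j * conjugate (Suc j) x) = R x"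
    unfolding R_def by (rule cyclic_sum) (use p_pos order_p z in \<open>auto simp: power_inverse\<close>)
  finally have eig: "\<sigma> (R x) = \<zeta> * R x" .
  define e where "e = R x"
  have e: "e \<noteq> 0" "\<sigma> e = \<zeta> * e" "\<sigma> e \<noteq> e" using x eig z by (auto simp: e_def)
  have "conjugate (Suc 0) (trace_one e) = trace_one e"
  proof -
    have zz: "conjugate j e = \<zeta> ^ j * e" for j
      by (induction j) (auto simp: conjugate_Suc e \<sigma>_mult \<sigma>_K[OF K_power[OF z(1)]] mult_ac)
    have img: "conjugates e - {e} = (\<lambda>j. conjugate j e) ` {1..<p}"
      using inj_on_image_set_diff[OF conjugate_inj_on[OF e(3)], of "{..<p}" "{0}"] p_pos
      by (auto simp: conjugates_def lessThan_minus_lessThan atLeast1_lessThan_eq_remove0)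
    have "(\<Prod>d\<in>conjugates e - {e}. e - d) = (\<Prod>j\<in>{1..<p}. e - conjugate j e)"
      unfolding img by (subst prod.reindex) (auto intro: inj_on_subset[OF conjugate_inj_on[OF e(3)]])
    also have "\<dots> = (\<Prod>j\<in>{1..<p}. e * (1 - \<zeta> ^ j))" by (simp add: zz algebra_simps)
    also have "\<dots> = e ^ (p - 1) * (\<Prod>j\<in>{1..<p}. 1 - \<zeta> ^ j)" by (simp add: prod.distrib)
    finally have t: "trace_one e = 1 / (\<Prod>j\<in>{1..<p}. 1 - \<zeta> ^ j)"
      using e(1) by (simp add: trace_one_def)
    have "conjugate (Suc 0) (\<zeta> ^ j) = \<zeta> ^ j" for j by (rule conjugate_K[OF K_power[OF z(1)]])
    then show ?thesis by (simp only: t conjugate_divide conjugate_prod conjugate_diff conjugate_one)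
  qed
  then have "trace_one e \<in> K" by (simp add: fixed_iff)
  then have "Tr (trace_one e) = of_nat p * trace_one e" by (simp add: Tr_def conjugate_K)
  then have p1: "of_nat p * trace_one e = 1" using Tr_trace_one[OF e(3)] by simp
  have t: "trace_one e \<noteq> 0 \<and> v (trace_one e) = - nmult (p - 1) (v (\<sigma> e - e) - v e)"
    by (rule v_trace_one) (use e in auto)
  have "v (of_nat p) + v (trace_one e) = 0"
    using v_mult[OF assms, of "trace_one e"] t p1 v_1 by simp
  then have "v (of_nat p) = nmult (p - 1) (v (\<sigma> e - e) - v e)"
    using t by simp
  then show ?thesis using S_I[of e] e by blast
qed

definition \<delta> :: "'a \<Rightarrow> 'a" where "\<delta> x = \<sigma> x - x"

lemma \<delta>_power:
  "(\<delta> ^^ n) x = (\<Sum>j\<le>n. of_int ((-1) ^ (n + j) * int (n choose j)) * conjugate j x)"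
proof (induction n)
  case (Suc n)
  let ?c = "\<lambda>n j. of_int ((-1) ^ (n + j) * int (n choose j)) :: 'a"
  have c_K: "?c n j \<in> K" for j
  proof -
    have "of_nat m \<in> K" for m by (induction m) (auto intro: K_closed)
    then have "(of_int i :: 'a) \<in> K" for i by (cases i rule: int_cases2) (auto intro: K_closed)
    then show ?thesis by blast
  qed
  have "(\<delta> ^^ Suc n) x = \<sigma> (\<Sum>j\<le>n. ?c n j * conjugate j x) - (\<Sum>j\<le>n. ?c n j * conjugate j x)"
    by (simp only: funpow.simps comp_apply Suc) (simp only: \<delta>_def)
  also have "\<sigma> (\<Sum>j\<le>n. ?c n j * conjugate j x) = (\<Sum>j\<le>n. ?c n j * conjugate (Suc j) x)"
    using conjugate_sum[of "Suc 0" "\<lambda>j. ?c n j * conjugate j x" "{..n}"] c_K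
    by (simp only: conjugate_Suc conjugate_0 \<sigma>_mult \<sigma>_K)
  also have "(\<Sum>j\<le>n. ?c n j * conjugate j x) = (\<Sum>j\<le>Suc n. ?c n j * conjugate j x)"
    by (simp add: binomial_eq_0)
  also have "\<dots> = ?c n 0 * x + (\<Sum>j\<le>n. ?c n (Suc j) * conjugate (Suc j) x)"
    by (subst sum.atMost_Suc_shift) simp
  also have "(\<Sum>j\<le>n. ?c n j * conjugate (Suc j) x) - \<dots> =
      ?c (Suc n) 0 * x + (\<Sum>j\<le>n. (?c n j - ?c n (Suc j)) * conjugate (Suc j) x)"
    by (simp add: distrib_right sum.distrib sum_negf del: of_int_mult of_int_power)
  also have "\<dots> = ?c (Suc n) 0 * x + (\<Sum>j\<le>n. ?c (Suc n) (Suc j) * conjugate (Suc j) x)"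
    by (simp add: algebra_simps)
  also have "\<dots> = (\<Sum>j\<le>Suc n. ?c (Suc n) j * conjugate j x)"
    unfolding sum.atMost_Suc_shift[of _ n] by simp
  finally show ?case .
qed simp

text \<open>
  Each application of \<open>\<delta>\<close> adds some element of \<open>S\<close> to the value. These elements vary, but all of them
  can be replaced by the smallest one.
\<close>
lemma \<delta>_power_vge:
  assumes "vge x 0"
  shows "\<exists>s\<in>S. vge ((\<delta> ^^ n) x) (nmult n s)"
proof (induction n)
  case 0
  then show ?case using assms S_nonempty by auto
next
  case (Suc n)
  then obtain s where s: "s \<in> S" "vge ((\<delta> ^^ n) x) (nmult n s)" by blast
  let ?z = "(\<delta> ^^ n) x"
  show ?case
  proof (cases "\<sigma> ?z = ?z")
    case True
    then have "(\<delta> ^^ Suc n) x = 0" by (simp add: \<delta>_def[of ?z])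
    with s show ?thesis by auto
  next
    case False
    then have z0: "?z \<noteq> 0" using \<sigma>_simps(1) by auto
    define t where "t = v (\<sigma> ?z - ?z) - v ?z"
    have t: "t \<in> S" unfolding t_def by (rule S_I[OF z0 False])
    define m where "m = min s t"
    have "m \<in> S" using s t by (simp add: m_def min_def)
    have "nmult (Suc n) m \<le> nmult n s + t"
      using nmult_mono[of m s n] by (simp add: m_def add_mono)
    also have "\<dots> \<le> v (\<sigma> ?z - ?z)" using s(2) z0 by (simp add: vge_def t_def algebra_simps)
    finally have "vge ((\<delta> ^^ Suc n) x) (nmult (Suc n) m)" by (simp add: vge_def \<delta>_def[of ?z])
    with \<open>m \<in> S\<close> show ?thesis by blast
  qed
qed

text \<open>
  Modulo \<open>p\<close> the trace is \<open>\<delta>\<^bsup>p-1\<^esup>\<close>, and \<open>v p\<close> is large enough for the correction term.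
\<close>
lemma Tr_vge:
  assumes "vge x 0"
  shows "\<exists>s\<in>S. vge (Tr x) (nmult (p - 1) s)"
proof -
  let ?c = "\<lambda>j. (-1) ^ (p - 1 + j) * int ((p - 1) choose j)"
  define e where "e j = (?c j - 1) div int p" for j
  have e: "?c j = 1 + int p * e j" if "j < p" for j
    using choose_prime_minus_one_cong[OF prime_p that] by (simp add: e_def)
  define r where "r = (\<Sum>j<p. of_int (e j) * conjugate j x)"
  have r: "vge r 0" unfolding r_def
    using vge_mult[OF vge_of_int vge_conj[OF assms]] by (intro vge_sum) simp
  have "(\<delta> ^^ (p - 1)) x = (\<Sum>j<p. of_int (?c j) * conjugate j x)"
    unfolding \<delta>_power using p_pos by (intro sum.cong) auto
  also have "\<dots> = (\<Sum>j<p. conjugate j x + of_nat p * (of_int (e j) * conjugate j x))"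
    by (intro sum.cong refl) (simp only: e lessThan_iff, simp add: algebra_simps)
  also have "\<dots> = Tr x + of_nat p * r"
    by (simp add: Tr_def r_def sum.distrib sum_distrib_left)
  finally have eq: "Tr x = (\<delta> ^^ (p - 1)) x - of_nat p * r" by simp
  obtain s where s: "s \<in> S" "vge ((\<delta> ^^ (p - 1)) x) (nmult (p - 1) s)"
    using \<delta>_power_vge[OF assms] by blast
  have "\<exists>t\<in>S. vge (of_nat p) (nmult (p - 1) t)"
    using v_p_ramification s(1) by (cases "of_nat p = (0::'a)") (auto simp: vge_def)
  then obtain t where t: "t \<in> S" "vge (of_nat p) (nmult (p - 1) t)" by blast
  have "vge (of_nat p * r) (nmult (p - 1) t)" using vge_mult[OF t(2) r] by simp
  then have "vge (Tr x) (nmult (p - 1) (min s t))" unfolding eq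
    using vge_trans[OF s(2) nmult_mono[of "min s t" s]] vge_trans[OF _ nmult_mono[of "min s t" t]]
    by (intro vge_diff) auto
  then show ?thesis using s t by (intro bexI[of _ "min s t"]) (auto simp: min_def)
qed

definition trace_ideal :: "'a set" where
  "trace_ideal = {b \<in> K. b = 0 \<or> (\<exists>s\<in>S. nmult (p - 1) s \<le> v b)}"

text \<open>
  Scaling \<open>trace_one c\<close> by \<open>b\<close> produces the trace \<open>b\<close>. Choosing \<open>c\<close> for an \<open>s\<close> strictly below the one
  that bounds \<open>v b\<close> makes the value of the scaled element positive.
\<close>
lemma trace_ideal_subset:
  assumes "b \<in> trace_ideal"
  shows "\<exists>x. (x = 0 \<or> 0 < v x) \<and> Tr x = b"
proof (cases "b = 0")
  case True
  then show ?thesis by (intro exI[of _ 0]) (simp add: Tr_def)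
next
  case False
  with assms obtain t where t: "t \<in> S" "nmult (p - 1) t \<le> v b" "b \<in> K"
    by (auto simp: trace_ideal_def)
  obtain s where s: "s \<in> S" "s < t" using S_no_least[OF t(1)] by blast
  obtain c where c: "c \<noteq> 0" "\<sigma> c \<noteq> c" "v c = 0" "v (\<sigma> c - c) = s" using S_unitE[OF s(1)] .
  note tc = v_trace_one[OF c(1,2)]
  have "nmult (p - 1) s < nmult (p - 1) t"
    using s p_gt_1 by (intro nmult_strict_mono) auto
  then have "0 < v (b * trace_one c)"
    using tc False t(2) by (simp add: v_mult c)
  moreover have "Tr (b * trace_one c) = b"
    using Tr_scale[OF t(3)] Tr_trace_one[OF c(2)] by simp
  ultimately show ?thesis by blast
qed

lemma Tr_val_ring: "Tr ` val_ring v UNIV = trace_ideal"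
  and Tr_max_ideal: "Tr ` max_ideal v UNIV = trace_ideal"
proof -
  have "Tr ` val_ring v UNIV \<subseteq> trace_ideal"
    using Tr_vge Tr_K by (auto simp: val_ring_def trace_ideal_def vge_def)
  moreover have "trace_ideal \<subseteq> Tr ` max_ideal v UNIV"
    using trace_ideal_subset by (force simp: max_ideal_def)
  moreover have "max_ideal v UNIV \<subseteq> val_ring v UNIV" by (auto simp: max_ideal_def val_ring_def)
  ultimately show "Tr ` val_ring v UNIV = trace_ideal" "Tr ` max_ideal v UNIV = trace_ideal"
    by (blast, blast)
qed

end

section \<open>Galois defect extensions of prime degree\<close>

text \<open>
  A root of \<open>1 + X + \<dots> + X\<^bsup>p-1\<^esup>\<close> in the algebraic closure is a root of unity, and different from \<open>1\<close>
  because \<open>p \<noteq> 0\<close>.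
\<close>
lemma primitive_root_in:
  assumes "contains_all_roots_of_unity p (K :: 'a::field set)" "p > 1" "of_nat p \<noteq> (0::'a)"
  shows "\<exists>\<zeta>\<in>K. \<zeta> ^ p = 1 \<and> \<zeta> \<noteq> 1"
proof -
  define q :: "'a alg_closure poly" where "q = (\<Sum>i<p. monom 1 i)"
  have "coeff q (p - 1) = 1" using assms(2) by (simp add: q_def coeff_sum)
  then have "0 < degree q" using assms(2) le_degree[of q "p - 1"] by simp
  then obtain z where z: "poly q z = 0" using alg_closed_imp_poly_has_root by blast
  then have sum0: "(\<Sum>i<p. z ^ i) = 0" by (simp add: q_def poly_sum poly_monom)
  then have "z ^ p = 1" using power_diff_1_eq[of z p] by simp
  then obtain \<zeta> where \<zeta>: "\<zeta> \<in> K" "z = to_ac \<zeta>"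
    using assms(1) by (auto simp: contains_all_roots_of_unity_def)
  have "\<zeta> \<noteq> 1"
  proof
    assume "\<zeta> = 1"
    then have "to_ac (of_nat p :: 'a) = 0" using sum0 \<zeta> by simp
    with assms(3) show False by (simp del: to_ac_of_nat)
  qed
  moreover have "to_ac (\<zeta> ^ p) = 1" using \<open>z ^ p = 1\<close> \<zeta> by simp
  ultimately show ?thesis using \<zeta>(1) by (auto simp del: to_ac_power)
qed

text \<open>
  The defect is a power of \<open>p\<close> greater than \<open>1\<close> and divides the degree \<open>p\<close>, so the ramification index
  and the inertia degree are \<open>1\<close>. Positive characteristic of \<open>L\<close> must be \<open>p\<close>, since it vanishes in
  the residue field.
\<close>
lemma immediate_cyclic_extension_of_defect:
  fixes K :: "'a::field set"
    and v :: "'a \<Rightarrow> 'g::linordered_ab_group_add"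
  assumes K: "subfield K ring_of_type_algebra"
    and v: "valuation v"
    and defect: "defect_extension K v"
    and p: "Factorial_Ring.prime p"
    and deg: "ext_degree (ring_of_type_algebra :: 'a ring) K = p"
    and char: "ring_char (residue_field v K) = p"
    and roots: "CHAR('a) = 0 \<Longrightarrow> contains_all_roots_of_unity p K"
    and \<sigma>: "\<sigma> \<in> galois_group K" "\<sigma> \<noteq> id"
  shows "immediate_cyclic_extension K \<sigma> p v"
proof -
  interpret valued_field v by unfold_locales (rule v)
  have p1: "p > 1" by (rule prime_gt_1_nat[OF p])
  have "char_exponent K v = p" using char p1 by (simp add: char_exponent_def)
  then obtain \<nu> where \<nu>: "p = p ^ \<nu> * ramification_index K v * inertia_degree K v" "p ^ \<nu> > 1"
    using defect deg by (auto simp: defect_extension_def)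
  have "p ^ \<nu> dvd p" using \<nu>(1) by (metis dvd_triv_left mult.assoc)
  moreover have "p dvd p ^ \<nu>" using \<nu>(2) by (cases \<nu>) auto
  ultimately have "p ^ \<nu> = p" by (rule dvd_antisym)
  then have "p * (ramification_index K v * inertia_degree K v) = p * 1"
    using \<nu>(1) by (simp add: mult.assoc)
  then have "ramification_index K v * inertia_degree K v = 1" using p1 by simp
  then have e: "ramification_index K v = 1" and f: "inertia_degree K v = 1" by simp_all
  note lift = ramification_index_one[OF K e]
  show ?thesis
  proof (intro immediate_cyclic_extension.intro immediate_cyclic_extension_axioms.intro)
    show "prime_cyclic_extension K \<sigma> p" by (rule prime_cyclic_extension.intro[OF K p deg \<sigma>])
    show "valued_field v" by (rule valued_field.intro[OF v])
    show "v (\<sigma> x) = v x" if "x \<noteq> 0" for x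
      using unibranched_invariant[OF K _ \<sigma>(1) lift that] defect by (simp add: defect_extension_def)
    show "\<exists>c\<in>K. c \<noteq> 0 \<and> v c = v x" if "x \<noteq> 0" for x by (rule lift[OF that])
    show "\<exists>c\<in>K. x = c \<or> 0 < v (x - c)" if "x \<noteq> 0" "v x = 0" for x
      by (rule inertia_degree_one[OF K f that])
    show "\<exists>\<zeta>\<in>K. \<zeta> ^ p = 1 \<and> \<zeta> \<noteq> 1" if "of_nat p \<noteq> (0::'a)"
    proof -
      have "CHAR('a) = 0"
      proof (rule ccontr)
        assume "CHAR('a) \<noteq> 0"
        then have "Factorial_Ring.prime CHAR('a)" by (intro prime_CHAR_semidom) simp
        moreover have "CHAR('a) \<in> {n. of_nat n \<in> max_ideal v K}"
          using subfield_record_closed(1)[OF K] by (simp add: max_ideal_def)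
        then have "p dvd CHAR('a)" using char ring_char_residue_field[OF K] by (metis Gcd_dvd)
        ultimately have "p = CHAR('a)" using p1 by (auto simp: prime_nat_iff)
        then show False using that by simp
      qed
      then show ?thesis using primitive_root_in[OF roots p1 that] by simp
    qed
  qed
qed

section \<open>The trace ideal, powers of the ramification ideal and independent defect\<close>

context immediate_cyclic_extension begin

text \<open>
  The candidates for the powers of the ideal of all \<open>a \<in> K\<close> with \<open>a = 0\<close> or \<open>v a \<in> S\<close>.
\<close>
definition value_level :: "nat \<Rightarrow> 'a set" where
  "value_level n = {b \<in> K. b = 0 \<or> (\<exists>s\<in>S. nmult n s \<le> v b)}"

lemma trace_ideal_eq: "trace_ideal = value_level (p - 1)"
  by (simp add: trace_ideal_def value_level_def)

lemma value_lift_group: "s \<in> value_group v UNIV \<Longrightarrow> \<exists>c\<in>K. c \<noteq> 0 \<and> v c = s"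
  using value_lift unfolding value_group_def by force

lemma value_group_K: "value_group v K = value_group v UNIV"
proof
  show "value_group v UNIV \<subseteq> value_group v K"
  proof
    fix s assume "s \<in> value_group v UNIV"
    then obtain c where "c \<in> K" "c \<noteq> 0" "v c = s" using value_lift_group by blast
    then show "s \<in> value_group v K" unfolding value_group_def by (intro image_eqI[of _ _ c]) auto
  qed
qed (auto simp: value_group_def)

lemma nmult_lift: "s \<in> S \<Longrightarrow> \<exists>c\<in>K. c \<noteq> 0 \<and> v c = nmult n s"
proof -
  assume "s \<in> S"
  then obtain c where c: "c \<in> K" "c \<noteq> 0" "v c = s" using value_lift_group S_subset by blast
  then show ?thesis
    using K_power[OF c(1)] v_power[OF c(2), of n] by (intro bexI[of _ "c ^ n"]) simp_all
qed

lemmas subring_O = subring_val_ring[OF subfield_K]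

lemma ideal_value_level: "ideal (value_level n) (ring_on (val_ring v K))"
proof (rule ideal_ring_onI[OF subring_O])
  have pos: "0 \<le> nmult n s" if "s \<in> S" for s
    using S_pos[OF that] by (intro nmult_nonneg) simp
  have mem: "b \<in> value_level n \<longleftrightarrow> b \<in> K \<and> (\<exists>s\<in>S. vge b (nmult n s))" for b
    using S_nonempty by (auto simp: value_level_def vge_def)
  show "value_level n \<subseteq> val_ring v K"
    using pos by (force simp: value_level_def val_ring_def)
  show "0 \<in> value_level n" using K_closed(1) by (simp add: value_level_def)
  show "x + y \<in> value_level n" if xy: "x \<in> value_level n" "y \<in> value_level n" for x y
  proof -
    obtain s t where st: "s \<in> S" "t \<in> S" "vge x (nmult n s)" "vge y (nmult n t)" "x \<in> K" "y \<in> K"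
      using xy unfolding mem by blast
    have "vge (x + y) (nmult n (min s t))"
      using vge_trans[OF st(3) nmult_mono[of "min s t" s]] vge_trans[OF st(4) nmult_mono[of "min s t" t]]
      by (intro vge_add) auto
    moreover have "min s t \<in> S" using st by (simp add: min_def)
    ultimately show ?thesis unfolding mem using K_closed(3) st by blast
  qed
  show "x * y \<in> value_level n" if x: "x \<in> val_ring v K" and y: "y \<in> value_level n" for x y
  proof -
    have "vge x 0" "x \<in> K" using x by (auto simp: val_ring_def vge_def)
    moreover obtain s where "s \<in> S" "vge y (nmult n s)" "y \<in> K" using y unfolding mem by blast
    moreover have "vge (x * y) (nmult n s)" using vge_mult[of x 0 y "nmult n s"] calculation by simp
    ultimately show ?thesis unfolding mem using K_closed(4) by blast
  qed
qed

lemma genideal_value_level: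
  "Idl\<^bsub>ring_on (val_ring v K)\<^esub> {b \<in> K. b \<noteq> 0 \<and> v b \<in> set_multiple n S} = value_level n"
proof (rule genideal_ring_on_eq[OF ideal_value_level])
  show "{b \<in> K. b \<noteq> 0 \<and> v b \<in> set_multiple n S} \<subseteq> value_level n"
    by (auto simp: value_level_def set_multiple_def)
  fix J assume J: "ideal J (ring_on (val_ring v K))"
    "{b \<in> K. b \<noteq> 0 \<and> v b \<in> set_multiple n S} \<subseteq> J"
  show "value_level n \<subseteq> J"
  proof
    fix b assume b: "b \<in> value_level n"
    show "b \<in> J"
    proof (cases "b = 0")
      case True
      then show ?thesis using ideal_ring_onD(2)[OF J(1)] by simp
    next
      case False
      with b obtain s where s: "s \<in> S" "nmult n s \<le> v b" "b \<in> K" by (auto simp: value_level_def)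
      obtain c where c: "c \<in> K" "c \<noteq> 0" "v c = nmult n s" using nmult_lift[OF s(1)] by blast
      then have "c \<in> J" using J(2) s(1) by (auto simp: set_multiple_def)
      moreover have "b / c \<in> val_ring v K"
        using s c False K_divide by (simp add: val_ring_def v_divide)
      ultimately have "b / c * c \<in> J" by (rule ideal_ring_onD(4)[OF J(1), rotated])
      then show ?thesis using c(2) by simp
    qed
  qed
qed

lemma ram_ideal_eq: "ram_ideal v \<sigma> \<inter> K = value_level 1"
proof -
  have "(\<exists>s\<in>S. s \<le> v a) \<longleftrightarrow> v a \<in> S" if "a \<noteq> 0" for a
  proof -
    have "v a \<in> value_group v UNIV" using that by (simp add: value_group_def)
    then show ?thesis using S_upward by blast
  qed
  then show ?thesis by (auto simp: ram_ideal_def value_level_def)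
qed

text \<open>
  An element \<open>b\<close> with \<open>v b \<ge> (n + 1) s\<close> factors as \<open>b / c * c\<close> for any \<open>c \<in> K\<close> of value \<open>s\<close>.
\<close>
lemma ideal_prod_value_level:
  "value_level n \<cdot>\<^bsub>ring_on (val_ring v K)\<^esub> value_level 1 = value_level (Suc n)"
proof
  let ?R = "ring_on (val_ring v K)"
  show "value_level n \<cdot>\<^bsub>?R\<^esub> value_level 1 \<subseteq> value_level (Suc n)"
  proof
    fix x assume "x \<in> value_level n \<cdot>\<^bsub>?R\<^esub> value_level 1"
    then show "x \<in> value_level (Suc n)"
    proof (induction rule: ideal_prod.induct)
      case (prod i j)
      show ?case
      proof (cases "i = 0 \<or> j = 0")
        case True
        then show ?thesis using K_closed(1) by (auto simp: value_level_def)
      next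
        case False
        with prod obtain s t where st: "s \<in> S" "nmult n s \<le> v i" "t \<in> S" "t \<le> v j"
          and K: "i \<in> K" "j \<in> K" by (auto simp: value_level_def)
        have "nmult (Suc n) (min s t) \<le> nmult n s + t"
          using nmult_mono[of "min s t" s n] by (simp add: add_mono)
        also have "\<dots> \<le> v (i * j)" using False st by (simp add: v_mult add_mono)
        finally have "nmult (Suc n) (min s t) \<le> v (i * j)" .
        moreover have "min s t \<in> S" using st by (simp add: min_def)
        ultimately show ?thesis using K K_closed(4) False by (auto simp: value_level_def simp del: sum.lessThan_Suc)
      qed
    next
      case (sum s1 s2)
      then show ?case using ideal_ring_onD(3)[OF ideal_value_level] by simp
    qed
  qed
  show "value_level (Suc n) \<subseteq> value_level n \<cdot>\<^bsub>?R\<^esub> value_level 1"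
  proof
    fix b assume b: "b \<in> value_level (Suc n)"
    show "b \<in> value_level n \<cdot>\<^bsub>?R\<^esub> value_level 1"
    proof (cases "b = 0")
      case True
      have "0 \<in> value_level m" for m using K_closed(1) by (simp add: value_level_def)
      from ideal_prod.prod[OF this[of n] this[of 1], of ?R] True show ?thesis by simp
    next
      case False
      with b obtain s where s: "s \<in> S" "nmult n s + s \<le> v b" "b \<in> K"
        by (auto simp: value_level_def)
      obtain c where c: "c \<in> K" "c \<noteq> 0" "v c = s" using value_lift_group s(1) S_subset by blast
      have "nmult n s \<le> v b - v c" using s(2) c(3) by (simp add: le_diff_eq)
      then have "b / c \<in> value_level n"
        using s c False K_divide by (auto simp: value_level_def v_divide)
      moreover have "c \<in> value_level 1" using c s(1) by (auto simp: value_level_def)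
      ultimately have "b / c * c \<in> value_level n \<cdot>\<^bsub>?R\<^esub> value_level 1"
        using ideal_prod.prod[of "b / c" "value_level n" c "value_level 1" ?R] by simp
      then show ?thesis using c(2) by simp
    qed
  qed
qed

lemma value_level_0: "value_level 0 = val_ring v K"
  using S_nonempty by (auto simp: value_level_def val_ring_def)

lemma ideal_power_value_level:
  "value_level 1 [^]\<^bsub>ideals_set (ring_on (val_ring v K))\<^esub> n = value_level n"
proof (induction n)
  case 0
  then show ?case by (simp add: nat_pow_def ideals_set_def value_level_0)
next
  case (Suc n)
  then show ?case using ideal_prod_value_level[of n] by (simp add: nat_pow_def ideals_set_def)
qed

lemma coarse_max_ideal_genideal:
  assumes "convex_subgroup (value_group v UNIV) H"
  shows "coarse_max_ideal v H UNIV \<inter> K =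
    Idl\<^bsub>ring_on (val_ring v K)\<^esub> {b \<in> K. b = 0 \<or> (\<forall>h\<in>H. h < v b)}"
proof -
  have eq: "coarse_max_ideal v H UNIV \<inter> K = coarse_max_ideal v H K"
    "{b \<in> K. b = 0 \<or> (\<forall>h\<in>H. h < v b)} = coarse_max_ideal v H K"
    by (auto simp: coarse_max_ideal_def)
  note I = ideal_ring_onD[OF ideal_coarse_max_ideal[OF subfield_K assms]]
  have 0: "0 \<in> H" by (rule convexD(2)[OF assms])
  have "ideal (coarse_max_ideal v H K) (ring_on (val_ring v K))"
  proof (rule ideal_ring_onI[OF subring_O])
    show "coarse_max_ideal v H K \<subseteq> val_ring v K"
      using 0 by (force simp: coarse_max_ideal_def val_ring_def)
    have "val_ring v K \<subseteq> coarse_ring v H K" using 0 by (auto simp: val_ring_def coarse_ring_def)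
    then show "x * y \<in> coarse_max_ideal v H K"
      if "x \<in> val_ring v K" "y \<in> coarse_max_ideal v H K" for x y
      using that I(4) by blast
  qed (use I in auto)
  then show ?thesis unfolding eq
    by (intro genideal_ring_on_eq[symmetric]) auto
qed

lemma p_minus_1_pos: "0 < p - 1"
  using p_gt_1 by simp

text \<open>
  From left to right, elements above \<open>H\<close> are divided by \<open>p - 1\<close> in the sense of
  \<open>strongly_convex_nmult_below\<close>. From right to left, \<open>H\<close> is closed under multiples, and \<open>S\<close> contains
  everything above one of its elements.
\<close>
lemma S_eq_above_iff:
  assumes H: "strongly_convex (value_group v UNIV) H"
  shows "S = above_subgroup v H \<longleftrightarrow> trace_ideal = coarse_max_ideal v H UNIV \<inter> K"
proof
  have conv: "convex_subgroup (value_group v UNIV) H" using H by (simp add: strongly_convex_def)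
  {
    assume S: "S = above_subgroup v H"
    show "trace_ideal = coarse_max_ideal v H UNIV \<inter> K"
    proof (intro equalityI subsetI)
      fix b assume b: "b \<in> trace_ideal"
      have "h < v b" if h: "h \<in> H" and b0: "b \<noteq> 0" for h
      proof -
        obtain s where s: "s \<in> S" "nmult (p - 1) s \<le> v b"
          using b b0 unfolding trace_ideal_def by blast
        have "h < s" using s(1) h S by (auto simp: above_subgroup_def)
        also have "s \<le> nmult (p - 1) s"
          using S_pos[OF s(1)] p_minus_1_pos by (intro nmult_ge) auto
        finally show ?thesis using s(2) by simp
      qed
      then show "b \<in> coarse_max_ideal v H UNIV \<inter> K"
        using b by (auto simp: coarse_max_ideal_def trace_ideal_def)
    next
      fix b assume b: "b \<in> coarse_max_ideal v H UNIV \<inter> K"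
      show "b \<in> trace_ideal"
      proof (cases "b = 0")
        case True
        then show ?thesis using K_closed(1) by (simp add: trace_ideal_def)
      next
        case False
        then have "v b \<in> value_group v UNIV" "\<forall>h\<in>H. h < v b"
          using b by (auto simp: value_group_def coarse_max_ideal_def)
        then obtain s where "s \<in> value_group v UNIV" "\<forall>h\<in>H. h < s" "nmult (p - 1) s \<le> v b"
          using strongly_convex_nmult_below[OF H p_minus_1_pos] by blast
        then show ?thesis using b by (auto simp: trace_ideal_def S above_subgroup_def)
      qed
    qed
  }
  {
    assume I: "trace_ideal = coarse_max_ideal v H UNIV \<inter> K"
    show "S = above_subgroup v H"
    proof (intro equalityI subsetI)
      fix s assume s: "s \<in> S"
      have "h < s" if h: "h \<in> H" for h
      proof (rule ccontr)
        assume "\<not> h < s"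
        then have le: "nmult (p - 1) s \<le> nmult (p - 1) h" by (intro nmult_mono) simp
        obtain c where c: "c \<in> K" "c \<noteq> 0" "v c = nmult (p - 1) s" using nmult_lift[OF s] by blast
        then have "c \<in> trace_ideal" using s by (auto simp: trace_ideal_def)
        then have "nmult (p - 1) h < v c"
          using convex_nmult[OF conv h] c(2) unfolding I by (auto simp: coarse_max_ideal_def)
        with le c(3) show False by simp
      qed
      then show "s \<in> above_subgroup v H" using s S_subset by (auto simp: above_subgroup_def)
    next
      fix a assume a: "a \<in> above_subgroup v H"
      then have a_val: "a \<in> value_group v UNIV" by (simp add: above_subgroup_def)
      obtain c where c: "c \<in> K" "c \<noteq> 0" "v c = a" using value_lift_group[OF a_val] by blast
      then have "c \<in> trace_ideal"
        unfolding I using a by (auto simp: coarse_max_ideal_def above_subgroup_def)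
      then obtain s where s: "s \<in> S" "nmult (p - 1) s \<le> a" using c by (auto simp: trace_ideal_def)
      have "s \<le> nmult (p - 1) s"
        using S_pos[OF s(1)] p_minus_1_pos by (intro nmult_ge) auto
      then show "a \<in> S" using S_upward[OF s(1) _ a_val] s(2) by simp
    qed
  }
qed

lemma field_trace_Tr: "field_trace K ` A = Tr ` A"
  by (rule image_cong) (simp_all add: field_trace_eq Tr_def)

lemma trace_condition_iff:
  assumes H: "strongly_convex (value_group v UNIV) H"
  shows "trace_condition K v H \<longleftrightarrow> S = above_subgroup v H"
  using coarse_max_ideal_genideal[of H] H
  unfolding trace_condition_def S_eq_above_iff[OF H] field_trace_Tr Tr_val_ring Tr_max_ideal
  by (simp add: strongly_convex_def)

text \<open>
  If the trace ideal is the maximal ideal of \<open>K\<close>, then \<open>S\<close> contains all positive values. As \<open>S\<close> has no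
  least element, neither do the positive values, so the trivial subgroup is strongly convex.
\<close>
lemma trace_max_ideal_iff:
  "trace_ideal = max_ideal v K \<longleftrightarrow>
    strongly_convex (value_group v UNIV) {0} \<and> S = above_subgroup v {0}"
proof -
  have eq: "coarse_max_ideal v {0} UNIV \<inter> K = max_ideal v K"
    by (auto simp: coarse_max_ideal_def max_ideal_def)
  have "strongly_convex (value_group v UNIV) {0}" if I: "trace_ideal = max_ideal v K"
  proof -
    have "a \<in> S" if a: "a \<in> value_group v UNIV" "0 < a" for a
    proof -
      obtain c where c: "c \<in> K" "c \<noteq> 0" "v c = a" using value_lift_group[OF a(1)] by blast
      then have "c \<in> trace_ideal" unfolding I using a(2) by (simp add: max_ideal_def)
      then obtain s where s: "s \<in> S" "nmult (p - 1) s \<le> a" using c by (auto simp: trace_ideal_def)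
      have "s \<le> nmult (p - 1) s"
        using S_pos[OF s(1)] p_minus_1_pos by (intro nmult_ge) auto
      then show ?thesis using S_upward[OF s(1) _ a(1)] s(2) by simp
    qed
    then have "\<exists>b\<in>value_group v UNIV. 0 < b \<and> b < a" if "a \<in> value_group v UNIV" "0 < a" for a
      using S_no_least S_pos S_subset that by blast
    moreover have "{0} \<noteq> value_group v UNIV"
    proof -
      obtain s where "s \<in> S" using S_nonempty by blast
      then have "s \<in> value_group v UNIV" "s \<noteq> 0" using S_subset S_pos[of s] by auto
      then show ?thesis by (metis singletonD)
    qed
    ultimately show ?thesis
      unfolding strongly_convex_iff using convex_subgroup_zero by auto
  qed
  then show ?thesis using S_eq_above_iff[of "{0}"] eq by auto
qed

lemma v_p_above:
  assumes "CHAR('a) = 0" "S = above_subgroup v H"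
  shows "\<forall>h\<in>H. h < v (of_nat p)"
proof
  fix h assume h: "h \<in> H"
  have "of_nat p \<noteq> (0::'a)" using assms(1) p_pos by (simp add: of_nat_eq_0_iff_char_dvd)
  then obtain s where s: "s \<in> S" "v (of_nat p) = nmult (p - 1) s"
    using v_p_ramification by blast
  have "h < s" using s(1) h assms(2) by (auto simp: above_subgroup_def)
  also have "s \<le> nmult (p - 1) s"
    using S_pos[OF s(1)] p_minus_1_pos by (intro nmult_ge) auto
  finally show "h < v (of_nat p)" using s(2) by simp
qed

text \<open>
  In mixed characteristic \<open>v p\<close> lies above \<open>H\<close>, so \<open>H\<close> is contained in every convex subgroup
  that contains \<open>v p\<close>.
\<close>
lemma archimedean_imp_trivial:
  assumes arch: "archimedean_group (value_group v K) \<or> archimedean_group (vp_group v K p)"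
    and H: "strongly_convex (value_group v UNIV) H" and S: "S = above_subgroup v H"
  shows "H = {0}"
proof -
  have conv: "convex_subgroup (value_group v UNIV) H" and ne: "H \<noteq> value_group v UNIV"
    using H by (simp_all add: strongly_convex_def)
  have trivial: "H = {0}" if "archimedean_group (value_group v K)"
    using archimedean_convex_trivial[OF _ conv convexD(1)[OF conv]] that
      proper_convex_bounded[OF conv ne] unfolding value_group_K by blast
  show ?thesis
  proof (cases "CHAR('a) = 0 \<and> archimedean_group (vp_group v K p)")
    case False
    then show ?thesis using arch trivial by (auto simp: vp_group_def)
  next
    case True
    note above = v_p_above[OF _ S]
    have vp: "v (of_nat p) \<in> vp_group v K p" using True by (simp add: vp_group_def)
    have "H \<subseteq> C" if C: "convex_subgroup (value_group v UNIV) C" "v (of_nat p) \<in> C" for C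
    proof
      fix h assume h: "h \<in> H"
      have "h \<le> v (of_nat p)" "- h \<le> v (of_nat p)"
        using above h convexD(4)[OF conv h] True by (simp_all add: less_imp_le)
      then have "- v (of_nat p) \<le> h" by (simp add: minus_le_iff)
      then show "h \<in> C"
        using convexD(4,6)[OF C(1)] C(2) \<open>h \<le> v (of_nat p)\<close> h convexD(1)[OF conv] by blast
    qed
    then have "H \<subseteq> vp_group v K p" using True by (auto simp: vp_group_def value_group_K)
    then show ?thesis
      by (rule archimedean_convex_trivial[OF conjunct2[OF True] conv _ vp])
        (rule above[OF conjunct1[OF True]])
  qed
qed

text \<open>
  An integer prime to \<open>p\<close> in the maximal ideal would, together with \<open>p\<close>, put \<open>1\<close> into that ideal.
\<close>
lemma ring_char_coarse_residue_field:
  assumes H: "convex_subgroup (value_group v UNIV) H" and above: "of_nat p \<in> coarse_max_ideal v H K"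
  shows "ring_char (coarse_residue_field v H K) = p"
proof -
  let ?I = "coarse_max_ideal v H K"
  note I = ideal_ring_onD[OF ideal_coarse_max_ideal[OF subfield_K H]]
  note A = subring_record_closed[OF subring_coarse_ring[OF subfield_K H]]
  have "(1::'a) \<notin> ?I" using convexD(2)[OF H] by (auto simp: coarse_max_ideal_def v_1)
  have int_A: "of_int m \<in> coarse_ring v H K" for m
  proof -
    have "of_nat m \<in> coarse_ring v H K" for m by (induction m) (use A in auto)
    then show ?thesis using A(5) by (cases m rule: int_cases2) auto
  qed
  have "of_nat n \<in> ?I \<longleftrightarrow> p dvd n" for n
  proof
    assume "p dvd n"
    then obtain k where "n = k * p" by (metis dvd_def mult.commute)
    then show "of_nat n \<in> ?I" using I(4)[OF int_A[of "int k"] above] by simp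
  next
    assume n: "of_nat n \<in> ?I"
    show "p dvd n"
    proof (rule ccontr)
      assume "\<not> p dvd n"
      then have "coprime (int p) (int n)" using prime_p by (simp add: prime_imp_coprime)
      then obtain a b where "a * int p + b * int n = 1" using bezout_int[of "int p" "int n"] by auto
      then have "of_int (a * int p + b * int n) = (1::'a)" by simp
      then have "of_int a * of_nat p + of_int b * of_nat n = (1::'a)" by simp
      moreover have "of_int a * of_nat p + of_int b * of_nat n \<in> ?I"
        using I(3)[OF I(4)[OF int_A above] I(4)[OF int_A n]] .
      ultimately show False using \<open>1 \<notin> ?I\<close> by simp
    qed
  qed
  then have "ring_char (coarse_residue_field v H K) = Gcd {n. p dvd n}"
    unfolding coarse_residue_field_def
    using ring_char_quotient[OF subring_coarse_ring[OF subfield_K H] ideal_coarse_max_ideal[OF subfield_K H]]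
    by simp
  also have "\<dots> = p"
    by (rule dvd_antisym) (auto intro: Gcd_dvd Gcd_greatest)
  finally show ?thesis .
qed

end

theorem theorem1p5:
  fixes K :: "'a::field set"
    and v :: "'a \<Rightarrow> 'g::linordered_ab_group_add"
    and \<sigma> :: "'a \<Rightarrow> 'a"
    and p :: nat
  assumes "subfield K ring_of_type_algebra"
    and "valuation v"
    and "finite_galois K"
    and "defect_extension K v"
    and "Factorial_Ring.prime p"
    and "ext_degree (ring_of_type_algebra :: 'a ring) K = p"
    and "ring_char (residue_field v K) = p"
    and "CHAR('a) = 0 \<Longrightarrow> contains_all_roots_of_unity p K"
    and "\<sigma> \<in> galois_group K" and "\<sigma> \<noteq> id"
  shows
    "(field_trace K ` val_ring v UNIV = field_trace K ` max_ideal v UNIV \<and>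
      field_trace K ` max_ideal v UNIV =
        Idl\<^bsub>ring_on (val_ring v K)\<^esub>
          {b \<in> K. b \<noteq> 0 \<and> v b \<in> set_multiple (p - 1) (ram_Sigma v \<sigma>)} \<and>
      Idl\<^bsub>ring_on (val_ring v K)\<^esub>
          {b \<in> K. b \<noteq> 0 \<and> v b \<in> set_multiple (p - 1) (ram_Sigma v \<sigma>)} =
        (ram_ideal v \<sigma> \<inter> K) [^]\<^bsub>ideals_set (ring_on (val_ring v K))\<^esub> (p - 1)) \<and>
     (independent_defect v \<sigma> \<longleftrightarrow>
        (\<exists>H. strongly_convex (value_group v UNIV) H \<and> trace_condition K v H)) \<and>
     (strongly_convex (value_group v UNIV) {0} \<and> ram_Sigma v \<sigma> = above_subgroup v {0} \<longleftrightarrow>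
        field_trace K ` max_ideal v UNIV = max_ideal v K) \<and>
     (strongly_convex (value_group v UNIV) {0} \<and> trace_condition K v {0} \<longleftrightarrow>
        field_trace K ` max_ideal v UNIV = max_ideal v K) \<and>
     (archimedean_group (value_group v K) \<or> archimedean_group (vp_group v K p) \<longrightarrow>
        (\<forall>H. strongly_convex (value_group v UNIV) H \<and>
             (ram_Sigma v \<sigma> = above_subgroup v H \<or> trace_condition K v H) \<longrightarrow> H = {0}) \<and>
        (independent_defect v \<sigma> \<longleftrightarrow>
           field_trace K ` max_ideal v UNIV = max_ideal v K)) \<and>
     (CHAR('a) = 0 \<longrightarrow>
        (\<forall>H. strongly_convex (value_group v UNIV) H \<and> trace_condition K v H \<longrightarrow>
             of_nat p \<in> coarse_max_ideal v H UNIV \<and>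
             ring_char (coarse_residue_field v H K) = p))"
proof -
  interpret immediate_cyclic_extension K \<sigma> p v
    by (rule immediate_cyclic_extension_of_defect[OF assms(1,2,4-10)])
  have trace: "field_trace K ` val_ring v UNIV = trace_ideal"
    "field_trace K ` max_ideal v UNIV = trace_ideal"
    by (simp_all only: field_trace_Tr Tr_val_ring Tr_max_ideal)
  have independent: "independent_defect v \<sigma> \<longleftrightarrow>
      (\<exists>H. strongly_convex (value_group v UNIV) H \<and> trace_condition K v H)"
    unfolding independent_defect_def using trace_condition_iff by blast
  have trivial: "H = {0}"
    if "archimedean_group (value_group v K) \<or> archimedean_group (vp_group v K p)"
      "strongly_convex (value_group v UNIV) H" "S = above_subgroup v H \<or> trace_condition K v H" for H
    using archimedean_imp_trivial[OF that(1,2)] that(3) trace_condition_iff[OF that(2)] by blast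
  have mixed: "of_nat p \<in> coarse_max_ideal v H UNIV \<and> ring_char (coarse_residue_field v H K) = p"
    if "CHAR('a) = 0" "strongly_convex (value_group v UNIV) H" "trace_condition K v H" for H
  proof -
    have above: "\<forall>h\<in>H. h < v (of_nat p)"
      using v_p_above[OF that(1)] trace_condition_iff[OF that(2)] that(3) by blast
    have "of_nat n \<in> K" for n by (induction n) (auto intro: K_closed)
    with above have "of_nat p \<in> coarse_max_ideal v H K" by (simp add: coarse_max_ideal_def)
    with above show ?thesis
      using ring_char_coarse_residue_field that(2)
      by (simp add: strongly_convex_def coarse_max_ideal_def)
  qed
  show ?thesis
  proof (intro conjI impI allI)
    show "field_trace K ` max_ideal v UNIV = Idl\<^bsub>ring_on (val_ring v K)\<^esub>
        {b \<in> K. b \<noteq> 0 \<and> v b \<in> set_multiple (p - 1) S}"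
      by (simp only: trace genideal_value_level trace_ideal_eq)
    show "Idl\<^bsub>ring_on (val_ring v K)\<^esub> {b \<in> K. b \<noteq> 0 \<and> v b \<in> set_multiple (p - 1) S} =
        (ram_ideal v \<sigma> \<inter> K) [^]\<^bsub>ideals_set (ring_on (val_ring v K))\<^esub> (p - 1)"
      by (simp only: genideal_value_level ram_ideal_eq ideal_power_value_level)
    show "strongly_convex (value_group v UNIV) {0} \<and> S = above_subgroup v {0} \<longleftrightarrow>
        field_trace K ` max_ideal v UNIV = max_ideal v K"
      unfolding trace trace_max_ideal_iff by (rule refl)
    show "strongly_convex (value_group v UNIV) {0} \<and> trace_condition K v {0} \<longleftrightarrow>
        field_trace K ` max_ideal v UNIV = max_ideal v K"
      unfolding trace trace_max_ideal_iff using trace_condition_iff by blast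
    show "independent_defect v \<sigma> \<longleftrightarrow> field_trace K ` max_ideal v UNIV = max_ideal v K"
      if "archimedean_group (value_group v K) \<or> archimedean_group (vp_group v K p)"
      unfolding trace trace_max_ideal_iff independent_defect_def using trivial[OF that] by blast
  qed (use trace independent trivial mixed in blast)+
qed

end
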